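(* Let $S$ be a semitopological monoid. A function $f\in C(S)$ is weakly almost periodic if and only if $f$ is a matrix coefficient of a weakly continuous antihomomorphism $h:S\to\Theta(V)$ for some reflexive Banach space $V$; that is, there exist a reflexive $V$, a weakly continuous antihomomorphism $h:S\to\Theta(V)$, and vectors $v\in V$, $\psi\in V^*$ such that $f(s)=\langle vs,\psi\rangle$ for all $s\in S$, where $vs:=h(s)(v)$. If $S=G$ is a group, then $h(G)\subset\mathrm{Is}(V)$.
   Context: A semitopological monoid is a monoid with a topology for which multiplication is separately continuous. $C(S)$ is the Banach space of bounded continuous real functions on $S$ with the sup norm; $(fs)(t)=f(st)$. $f\in C(S)$ is weakly almost periodic ($f\in\mathrm{WAP}(S)$) if $fS=\{fs:s\in S\}$ is relatively weakly compact in $C(S)$. For a real Banach space $V$, $\Theta(V)=\{\sigma\in L(V,V):\|\sigma\|\le1\}$ and $\mathrm{Is}(V)$ is the group of linear surjective isometries of $V$. An antihomomorphism satisfies $h(st)=h(t)h(s)$, and the identity of $S$ acts as the identity operator. "Weakly continuous" means continuous with respect to the weak operator topology on $\Theta(V)$. *)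

theory Defs
  imports "HOL-Analysis.Analysis"
begin

class semitopological_monoid = monoid_mult + topological_space +
  assumes open_vimage_mult_left: "open U \<Longrightarrow> open ((\<lambda>t. s * t) -` U)"
    and open_vimage_mult_right: "open U \<Longrightarrow> open ((\<lambda>s. s * t) -` U)"

lemma continuous_mult_left: "continuous_on UNIV (\<lambda>t::'s::semitopological_monoid. s * t)"
  by (simp add: continuous_on_open_vimage open_vimage_mult_left)

lemma continuous_mult_right: "continuous_on UNIV (\<lambda>s::'s::semitopological_monoid. s * t)"
  by (simp add: continuous_on_open_vimage open_vimage_mult_right)

definition weak_topology :: "'a::real_normed_vector topology" where
  "weak_topology = topology_generated_by
     {\<phi> -` U |(\<phi> :: 'a \<Rightarrow> real) U. bounded_linear \<phi> \<and> open U}"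

definition relatively_weakly_compact :: "'a::real_normed_vector set \<Rightarrow> bool" where
  "relatively_weakly_compact A \<longleftrightarrow>
     compactin weak_topology (weak_topology closure_of A)"

text \<open>\<open>C(S)\<close> is the library type \<^typ>\<open>'s \<Rightarrow>\<^sub>C real\<close>.\<close>

definition translate :: "('s::semitopological_monoid \<Rightarrow>\<^sub>C real) \<Rightarrow> 's \<Rightarrow> ('s \<Rightarrow>\<^sub>C real)" where
  "translate f s = Bcontfun (\<lambda>t. apply_bcontfun f (s * t))"

lemma apply_translate [simp]: "apply_bcontfun (translate f s) t = apply_bcontfun f (s * t)"
proof -
  have "continuous_on UNIV (\<lambda>t. apply_bcontfun f (s * t))"
    by (rule continuous_on_compose2[OF continuous_on_apply_bcontfun continuous_mult_left]) auto
  moreover have "bounded (range (\<lambda>t. apply_bcontfun f (s * t)))"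
    by (rule bounded_subset[of "range (apply_bcontfun f)"]) (auto simp: bounded_apply_bcontfun)
  ultimately show ?thesis
    by (simp add: translate_def Bcontfun_inverse bcontfun_def)
qed

definition weakly_almost_periodic :: "('s::semitopological_monoid \<Rightarrow>\<^sub>C real) \<Rightarrow> bool" where
  "weakly_almost_periodic f \<longleftrightarrow> relatively_weakly_compact (range (translate f))"

text \<open>
  Types cannot be existentially quantified, so the representation space is a pair \<open>(V, N)\<close>: a
  linear subspace \<open>V\<close> of an ambient vector space type, and a norm \<open>N\<close> on \<open>V\<close>. The norm is unrelated
  to any norm of the ambient type, and its values outside \<open>V\<close> are irrelevant.
\<close>

locale banach_space_on =
  fixes V :: "'v::real_vector set" and N :: "'v \<Rightarrow> real"
  assumes subspace: "subspace V"
    and norm_nonneg: "x \<in> V \<Longrightarrow> 0 \<le> N x"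
    and norm_eq_0: "x \<in> V \<Longrightarrow> N x = 0 \<longleftrightarrow> x = 0"
    and norm_triangle: "x \<in> V \<Longrightarrow> y \<in> V \<Longrightarrow> N (x + y) \<le> N x + N y"
    and norm_scaleR: "x \<in> V \<Longrightarrow> N (c *\<^sub>R x) = \<bar>c\<bar> * N x"
    and complete: "range u \<subseteq> V \<Longrightarrow> (\<forall>e>0. \<exists>M. \<forall>m\<ge>M. \<forall>n\<ge>M. N (u m - u n) < e) \<Longrightarrow>
      \<exists>l\<in>V. (\<lambda>n. N (u n - l)) \<longlonglongrightarrow> 0"

definition linear_map_on :: "'v::real_vector set \<Rightarrow> ('v \<Rightarrow> 'w::real_vector) \<Rightarrow> bool" where
  "linear_map_on V T \<longleftrightarrow>
     (\<forall>x\<in>V. \<forall>y\<in>V. T (x + y) = T x + T y) \<and> (\<forall>c. \<forall>x\<in>V. T (c *\<^sub>R x) = c *\<^sub>R T x)"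

text \<open>
  Functionals on \<open>V\<close> are normalised to vanish off \<open>V\<close>, so that every element of the dual space is
  represented by exactly one function and the dual is closed under pointwise operations.
\<close>

definition dual_space :: "'v::real_vector set \<Rightarrow> ('v \<Rightarrow> real) \<Rightarrow> ('v \<Rightarrow> real) set" where
  "dual_space V N = {\<phi>. linear_map_on V \<phi> \<and> (\<exists>B. \<forall>x\<in>V. \<bar>\<phi> x\<bar> \<le> B * N x) \<and> (\<forall>x. x \<notin> V \<longrightarrow> \<phi> x = 0)}"

definition dual_norm :: "'v::real_vector set \<Rightarrow> ('v \<Rightarrow> real) \<Rightarrow> ('v \<Rightarrow> real) \<Rightarrow> real" where
  "dual_norm V N \<phi> = (SUP x\<in>{x \<in> V. N x \<le> 1}. \<bar>\<phi> x\<bar>)"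

text \<open>Every bounded linear functional \<open>\<Lambda>\<close> on the dual space is evaluation at a point of \<open>V\<close>.\<close>

definition reflexive_on :: "'v::real_vector set \<Rightarrow> ('v \<Rightarrow> real) \<Rightarrow> bool" where
  "reflexive_on V N \<longleftrightarrow>
     (\<forall>\<Lambda> :: ('v \<Rightarrow> real) \<Rightarrow> real.
        (\<forall>\<phi>\<in>dual_space V N. \<forall>\<psi>\<in>dual_space V N. \<Lambda> (\<lambda>x. \<phi> x + \<psi> x) = \<Lambda> \<phi> + \<Lambda> \<psi>) \<longrightarrow>
        (\<forall>c. \<forall>\<phi>\<in>dual_space V N. \<Lambda> (\<lambda>x. c * \<phi> x) = c * \<Lambda> \<phi>) \<longrightarrow>
        (\<exists>B. \<forall>\<phi>\<in>dual_space V N. \<bar>\<Lambda> \<phi>\<bar> \<le> B * dual_norm V N \<phi>) \<longrightarrow>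
        (\<exists>v\<in>V. \<forall>\<phi>\<in>dual_space V N. \<Lambda> \<phi> = \<phi> v))"

text \<open>
  Operators on \<open>V\<close> are extensional functions, so the composition in the monoid of operators is
  \<^term>\<open>compose V\<close> and its identity is \<^term>\<open>restrict id V\<close>.
\<close>

definition bounded_operators :: "'v::real_vector set \<Rightarrow> ('v \<Rightarrow> real) \<Rightarrow> ('v \<Rightarrow> 'v) set" where
  "bounded_operators V N =
     {T \<in> V \<rightarrow>\<^sub>E V. linear_map_on V T \<and> (\<exists>B. \<forall>x\<in>V. N (T x) \<le> B * N x)}"

definition operator_norm :: "'v::real_vector set \<Rightarrow> ('v \<Rightarrow> real) \<Rightarrow> ('v \<Rightarrow> 'v) \<Rightarrow> real" where
  "operator_norm V N T = (SUP x\<in>{x \<in> V. N x \<le> 1}. N (T x))"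

definition contractions :: "'v::real_vector set \<Rightarrow> ('v \<Rightarrow> real) \<Rightarrow> ('v \<Rightarrow> 'v) set" where
  "contractions V N = {T \<in> bounded_operators V N. operator_norm V N T \<le> 1}"

definition isometries :: "'v::real_vector set \<Rightarrow> ('v \<Rightarrow> real) \<Rightarrow> ('v \<Rightarrow> 'v) set" where
  "isometries V N =
     {T \<in> V \<rightarrow>\<^sub>E V. linear_map_on V T \<and> T ` V = V \<and> (\<forall>x\<in>V. N (T x) = N x)}"

definition weak_operator_topology ::
    "'v::real_vector set \<Rightarrow> ('v \<Rightarrow> real) \<Rightarrow> ('v \<Rightarrow> 'v) topology" where
  "weak_operator_topology V N = subtopology
     (topology_generated_by
        {{T. \<phi> (T v) \<in> U} |\<phi> v U. \<phi> \<in> dual_space V N \<and> v \<in> V \<and> open U})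
     (contractions V N)"

definition antihomomorphism_on ::
    "'v::real_vector set \<Rightarrow> ('s::monoid_mult \<Rightarrow> 'v \<Rightarrow> 'v) \<Rightarrow> bool" where
  "antihomomorphism_on V h \<longleftrightarrow>
     h 1 = restrict id V \<and> (\<forall>s t. h (s * t) = compose V (h t) (h s))"

definition reflexive_representation ::
    "'v::real_vector set \<Rightarrow> ('v \<Rightarrow> real) \<Rightarrow> ('s::semitopological_monoid \<Rightarrow> 'v \<Rightarrow> 'v) \<Rightarrow> bool" where
  "reflexive_representation V N h \<longleftrightarrow>
     banach_space_on V N \<and> reflexive_on V N \<and> range h \<subseteq> contractions V N \<and>
     antihomomorphism_on V h \<and> continuous_map euclidean (weak_operator_topology V N) h"

definition matrix_coefficient ::
    "'v::real_vector set \<Rightarrow> ('v \<Rightarrow> real) \<Rightarrow> ('s \<Rightarrow> 'v \<Rightarrow> 'v) \<Rightarrow> ('s \<Rightarrow> real) \<Rightarrow> bool" where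
  "matrix_coefficient V N h f \<longleftrightarrow> (\<exists>v\<in>V. \<exists>\<psi>\<in>dual_space V N. \<forall>s. f s = \<psi> (h s v))"

end

theory Submission
  imports Defs "HOL-Complex_Analysis.Great_Picard"
begin

text \<open>
  Let \<open>W\<close> be the symmetric convex hull of the orbit of a weakly almost periodic \<open>f\<close>. It is relatively weakly
  compact by Krein's theorem, so the interpolation space of Davis, Figiel, Johnson and Pelczynski
  between \<open>W\<close> and \<open>C(S)\<close> is reflexive. Translations preserve \<open>W\<close> and contract \<open>C(S)\<close>, hence they act on that
  space by contractions, and \<open>f s\<close> is the value at \<open>1\<close> of \<open>f\<close> translated by \<open>s\<close>. On weakly compact balls the weak topology is induced by
  the evaluations at points of \<open>S\<close>, which gives weak continuity. Conversely, a coefficient \<open>\<psi>\<close> of a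
  representation on \<open>V\<close> defines a bounded operator \<open>u \<mapsto> (t \<mapsto> \<psi> (h t u))\<close> from \<open>V\<close> to \<open>C(S)\<close>, which maps the orbit of
  \<open>v\<close> onto that of \<open>f\<close> and weakly compact balls to weakly compact sets.
\<close>

section \<open>Hahn-Banach and Mazur\<close>

text \<open>Compactness of the hull is never stated as such. Krein's theorem takes the form that a
  linear functional on the dual of the ambient space is evaluation at a point as soon as, for every
  error \<open>e\<close>, points within \<open>e\<close> of some multiple \<open>r\<close> of the
  hull approximate it on finite sets. The multiple must be allowed to depend on \<open>e\<close>: an
  element of a ball of the interpolation space need not lie in a multiple of \<open>W\<close>, but
  for each \<open>n\<close> it lies within \<open>2^-n b\<close> of \<open>2^n b\<close> times
  \<open>W\<close>, with a fixed \<open>b\<close>. The point so obtained represents a functional on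
  the dual of \<open>V\<close> only on restrictions of ambient functionals, and these need not
  exhaust that dual. The others are reached by a growth argument: since the interpolation norm is an
  l2 sum, \<open>p\<close> almost disjoint blocks have norm of order \<open>sqrt p\<close>, while a
  persistent discrepancy would make a functional grow like \<open>p\<close> on them. Krein's theorem
  is proved without measures on the compact set: Simons' inequality turns a lower bound for all
  convex combinations of functionals into one at a single point of that set.\<close>

definition sublinear :: "('a::real_vector \<Rightarrow> real) \<Rightarrow> bool" where
  "sublinear p \<longleftrightarrow> (\<forall>x y. p (x + y) \<le> p x + p y) \<and> (\<forall>c\<ge>0. \<forall>x. p (c *\<^sub>R x) = c * p x)"

lemma sublinearI:
  assumes "\<And>x y. p (x + y) \<le> p x + p y"
    and "\<And>c x. 0 < c \<Longrightarrow> p (c *\<^sub>R x) \<le> c * p x" and "p 0 = 0"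
  shows "sublinear p"
  unfolding sublinear_def
proof (intro conjI allI impI)
  fix c :: real and x
  assume "0 \<le> c"
  show "p (c *\<^sub>R x) = c * p x"
  proof (cases "c = 0")
    case False
    with \<open>0 \<le> c\<close> have c: "0 < c" by simp
    have "p x = p (inverse c *\<^sub>R (c *\<^sub>R x))" using c by simp
    also have "\<dots> \<le> inverse c * p (c *\<^sub>R x)" using c assms(2) by (metis inverse_positive_iff_positive)
    finally have "c * p x \<le> p (c *\<^sub>R x)" using c by (simp add: field_simps)
    with assms(2)[OF c, of x] show ?thesis by simp
  qed (simp add: assms(3))
qed (rule assms(1))

lemma sublinear_add: "sublinear p \<Longrightarrow> p (x + y) \<le> p x + p y"
  and sublinear_scaleR: "sublinear p \<Longrightarrow> 0 \<le> c \<Longrightarrow> p (c *\<^sub>R x) = c * p x"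
  by (auto simp: sublinear_def)

lemma sublinear_0: "sublinear p \<Longrightarrow> p 0 = 0"
  using sublinear_scaleR[of p 0 0] by simp

lemma sublinear_lower: "sublinear p \<Longrightarrow> - p (- x) \<le> p x"
  using sublinear_add[of p x "- x"] sublinear_0[of p] by simp

text \<open>Zorn's lemma in the reversed pointwise order, so that the bound of a chain is its
  infimum. The infimum is finite because \<open>q \<le> p\<close> forces
  \<open>- p (- x) \<le> q x\<close>, and subadditive because two members of a chain can both be
  replaced by the smaller one.\<close>

lemma minimal_sublinear:
  assumes "sublinear p"
  obtains q where "sublinear q" "q \<le> p" "\<And>r. sublinear r \<Longrightarrow> r \<le> q \<Longrightarrow> r = q"
proof -
  define A where "A = {q. sublinear q \<and> q \<le> p}"
  define P where "P = (\<lambda>q r :: 'a \<Rightarrow> real. r \<le> q)"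
  have "\<exists>m\<in>A. \<forall>a\<in>A. P m a \<longrightarrow> a = m"
  proof (rule predicate_Zorn)
    show "partial_order_on A (relation_of P A)"
      by (rule partial_order_on_relation_ofI) (auto simp: P_def)
  next
    fix C assume "C \<in> Chains (relation_of P A)"
    then have tot: "\<And>q r. q \<in> C \<Longrightarrow> r \<in> C \<Longrightarrow> q \<le> r \<or> r \<le> q" and CA: "C \<subseteq> A"
      by (auto simp: Chains_def relation_of_def P_def)
    show "\<exists>u\<in>A. \<forall>a\<in>C. P a u"
    proof (cases "C = {}")
      case True
      then show ?thesis using assms by (auto simp: A_def)
    next
      case False
      define u where "u x = (INF q\<in>C. q x)" for x
      have bdd: "bdd_below ((\<lambda>q. q x) ` C)" for x
      proof (rule bdd_belowI2)
        fix q assume "q \<in> C"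
        then have "sublinear q" "q \<le> p" using CA by (auto simp: A_def)
        then show "- p (- x) \<le> q x" using sublinear_lower[of q x] by (auto simp: le_fun_def intro: order_trans[OF le_imp_neg_le])
      qed
      have le: "u x \<le> q x" if "q \<in> C" for q x
        unfolding u_def using bdd that by (rule cINF_lower)
      have sub: "sublinear q" if "q \<in> C" for q using that CA by (auto simp: A_def)
      have "sublinear u"
      proof (rule sublinearI)
        fix x y
        have "u (x + y) - q x \<le> u y" if q: "q \<in> C" for q
          unfolding u_def[of y]
        proof (rule cINF_greatest[OF False])
          fix r assume r: "r \<in> C"
          obtain s where s: "s \<in> C" "s \<le> q" "s \<le> r" using tot[OF q r] q r by auto
          have "u (x + y) \<le> s (x + y)" by (rule le[OF s(1)])
          also have "\<dots> \<le> s x + s y" by (rule sublinear_add[OF sub[OF s(1)]])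
          also have "\<dots> \<le> q x + r y" using s by (auto simp: le_fun_def intro: add_mono)
          finally show "u (x + y) - q x \<le> r y" by simp
        qed
        then have "u (x + y) - u y \<le> u x"
          unfolding u_def[of x] by (intro cINF_greatest[OF False]) (simp add: algebra_simps)
        then show "u (x + y) \<le> u x + u y" by simp
      next
        fix c :: real and x assume c: "0 < c"
        have "u (c *\<^sub>R x) / c \<le> u x"
          unfolding u_def[of x]
        proof (rule cINF_greatest[OF False])
          fix q assume q: "q \<in> C"
          have "u (c *\<^sub>R x) \<le> c * q x"
            using le[OF q, of "c *\<^sub>R x"] sublinear_scaleR[OF sub[OF q], of c x] c by simp
          then show "u (c *\<^sub>R x) / c \<le> q x" using c by (simp add: field_simps)
        qed
        then show "u (c *\<^sub>R x) \<le> c * u x" using c by (simp add: field_simps)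
      next
        have "(\<lambda>q. q 0) ` C = {0}" using False sub sublinear_0 by (auto simp: image_iff)
        then show "u 0 = 0" by (simp add: u_def)
      qed
      moreover have "u \<le> p"
      proof -
        obtain q where "q \<in> C" using False by auto
        then have "u \<le> q" "q \<le> p" using le CA by (auto simp: le_fun_def A_def)
        then show ?thesis by (rule order_trans)
      qed
      ultimately show ?thesis using le by (auto simp: A_def P_def le_fun_def)
    qed
  qed
  then obtain m where "m \<in> A" "\<forall>a\<in>A. a \<le> m \<longrightarrow> a = m" by (auto simp: P_def)
  moreover have "r \<in> A" if "sublinear r" "r \<le> m" for r
    using that \<open>m \<in> A\<close> by (auto simp: A_def)
  ultimately show ?thesis by (intro that[of m]) (auto simp: A_def)
qed

text \<open>A minimal sublinear functional \<open>q\<close> is additive, since \<open>x \<mapsto> inf\<^sub>t (q (x + t y) - t q y)\<close> is a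
  sublinear functional below \<open>q\<close>.\<close>

lemma hahn_banach_sublinear:
  fixes p :: "'a::real_vector \<Rightarrow> real"
  assumes "sublinear p"
  obtains f where "linear f" "\<And>x. f x \<le> p x"
proof -
  obtain q where q: "sublinear q" "q \<le> p" and min: "\<And>r. sublinear r \<Longrightarrow> r \<le> q \<Longrightarrow> r = q"
    using minimal_sublinear[OF assms] by metis
  have key: "q x + q y \<le> q (x + y)" for x y
  proof -
    define r where "r x = (INF t\<in>{0..}. q (x + t *\<^sub>R y) - t * q y)" for x
    have lb: "- q (- x) \<le> q (x + t *\<^sub>R y) - t * q y" if "0 \<le> t" for x t
      using sublinear_add[OF q(1), of "x + t *\<^sub>R y" "- x"] sublinear_scaleR[OF q(1) that, of y] by simp
    have bdd: "bdd_below ((\<lambda>t. q (x + t *\<^sub>R y) - t * q y) ` {0..})" for x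
      by (rule bdd_belowI2[of _ "- q (- x)"]) (simp add: lb)
    have le: "r x \<le> q (x + t *\<^sub>R y) - t * q y" if "0 \<le> t" for x t
      unfolding r_def using bdd that by (intro cINF_lower) auto
    have ge: "z \<le> r x" if "\<And>t. 0 \<le> t \<Longrightarrow> z \<le> q (x + t *\<^sub>R y) - t * q y" for x z
      unfolding r_def using that by (intro cINF_greatest) auto
    have rq: "r \<le> q" using le[of 0] by (simp add: le_fun_def)
    have "sublinear r"
    proof (rule sublinearI)
      fix a b
      have "r (a + b) - (q (a + s *\<^sub>R y) - s * q y) \<le> r b" if s: "0 \<le> s" for s
      proof (rule ge)
        fix t :: real assume t: "0 \<le> t"
        have "r (a + b) \<le> q (a + b + (s + t) *\<^sub>R y) - (s + t) * q y" using s t by (intro le) simp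
        moreover have "q (a + b + (s + t) *\<^sub>R y) \<le> q (a + s *\<^sub>R y) + q (b + t *\<^sub>R y)"
          using sublinear_add[OF q(1), of "a + s *\<^sub>R y" "b + t *\<^sub>R y"] by (simp add: algebra_simps)
        ultimately show "r (a + b) - (q (a + s *\<^sub>R y) - s * q y) \<le> q (b + t *\<^sub>R y) - t * q y"
          by (simp add: algebra_simps)
      qed
      then have "r (a + b) - r b \<le> r a" by (intro ge) (simp add: algebra_simps)
      then show "r (a + b) \<le> r a + r b" by simp
    next
      fix c :: real and x assume c: "0 < c"
      have "r (c *\<^sub>R x) / c \<le> r x"
      proof (rule ge)
        fix t :: real assume t: "0 \<le> t"
        have "r (c *\<^sub>R x) \<le> q (c *\<^sub>R x + (c * t) *\<^sub>R y) - (c * t) * q y" using c t by (intro le) simp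
        also have "q (c *\<^sub>R x + (c * t) *\<^sub>R y) = c * q (x + t *\<^sub>R y)"
          using sublinear_scaleR[OF q(1), of c "x + t *\<^sub>R y"] c by (simp add: algebra_simps)
        finally show "r (c *\<^sub>R x) / c \<le> q (x + t *\<^sub>R y) - t * q y" using c by (simp add: field_simps)
      qed
      then show "r (c *\<^sub>R x) \<le> c * r x" using c by (simp add: field_simps)
    next
      show "r 0 = 0"
      proof (rule antisym)
        show "r 0 \<le> 0" using le[of 0 0] sublinear_0[OF q(1)] by simp
        show "0 \<le> r 0" using sublinear_scaleR[OF q(1)] by (intro ge) simp
      qed
    qed
    \<comment> \<open>Minimality gives \<open>r = q\<close>, and the parameter \<open>t = 1\<close>
      then yields superadditivity of \<open>q\<close>.\<close>
    from min[OF this rq] have "q x = r x" by simp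
    also have "\<dots> \<le> q (x + 1 *\<^sub>R y) - 1 * q y" by (rule le) simp
    finally show ?thesis by simp
  qed
  have add: "q (x + y) = q x + q y" for x y
    using key[of x y] sublinear_add[OF q(1), of x y] by simp
  have neg: "q (- x) = - q x" for x using add[of x "- x"] sublinear_0[OF q(1)] by simp
  have "linear q"
  proof (rule linearI)
    fix c :: real and x
    show "q (c *\<^sub>R x) = c *\<^sub>R q x"
    proof (cases "0 \<le> c")
      case False
      then have "q (c *\<^sub>R x) = - q ((- c) *\<^sub>R x)" using neg[of "(- c) *\<^sub>R x"] by simp
      also have "\<dots> = c * q x" using False sublinear_scaleR[OF q(1), of "- c" x] by simp
      finally show ?thesis by simp
    qed (simp add: sublinear_scaleR[OF q(1)])
  qed (rule add)
  then show ?thesis using q(2) by (intro that[of q]) (auto simp: le_fun_def)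
qed

lemma hahn_banach_blinfun:
  fixes p :: "'a::real_normed_vector \<Rightarrow> real"
  assumes "sublinear p" "\<And>x. p x \<le> norm x"
  obtains F :: "'a \<Rightarrow>\<^sub>L real" where "norm F \<le> 1" "\<And>x. F x \<le> p x"
proof -
  obtain f where f: "linear f" "\<And>x. f x \<le> p x" using hahn_banach_sublinear[OF assms(1)] by metis
  have bd: "\<bar>f x\<bar> \<le> norm x" for x
    using f(2)[of x] f(2)[of "- x"] assms(2)[of x] assms(2)[of "- x"] linear_neg[OF f(1), of x] by auto
  then have "bounded_linear f"
    using f(1) by (intro bounded_linear_intro[of _ 1]) (auto simp: linear_add linear_scale)
  then have F: "blinfun_apply (Blinfun f) = f" by (rule bounded_linear_Blinfun_apply)
  show ?thesis
  proof (rule that[of "Blinfun f"])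
    show "norm (Blinfun f) \<le> 1" by (rule norm_blinfun_bound) (use bd F in auto)
  qed (simp add: F f(2))
qed

text \<open>The functional is dominated by \<open>x \<mapsto> inf (\<parallel>x + t c\<parallel> - t d)\<close> over \<open>t \<ge> 0\<close> and \<open>c \<in> C\<close>.\<close>

lemma separate_convex_from_0:
  fixes C :: "'a::real_normed_vector set"
  assumes "convex C" "\<And>c. c \<in> C \<Longrightarrow> d \<le> norm c"
  obtains F :: "'a \<Rightarrow>\<^sub>L real" where "norm F \<le> 1" "\<And>c. c \<in> C \<Longrightarrow> d \<le> F c"
proof (cases "C = {}")
  case True
  then show ?thesis by (intro that[of 0]) auto
next
  case False
  define I where "I = {0::real..} \<times> C"
  define g where "g x = (\<lambda>(t, c). norm (x + t *\<^sub>R c) - t * d)" for x :: 'a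
  define p where "p x = (INF i\<in>I. g x i)" for x
  have I: "I \<noteq> {}" using False by (auto simp: I_def)
  have bdd: "bdd_below (g x ` I)" for x
  proof (rule bdd_belowI2[of _ "- norm x"])
    fix i assume "i \<in> I"
    then obtain t c where i: "i = (t, c)" "0 \<le> t" "c \<in> C" by (auto simp: I_def)
    have "t * d \<le> norm (t *\<^sub>R c)" using i assms(2) by (simp add: mult_left_mono)
    also have "\<dots> \<le> norm (x + t *\<^sub>R c) + norm x" using norm_triangle_ineq4[of "x + t *\<^sub>R c" x] by simp
    finally show "- norm x \<le> g x i" by (simp add: g_def i)
  qed
  have le: "p x \<le> norm (x + t *\<^sub>R c) - t * d" if "0 \<le> t" "c \<in> C" for x t c
    using cINF_lower[OF bdd[of x], of "(t, c)"] that by (simp add: p_def g_def I_def)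
  have ge: "z \<le> p x" if "\<And>t c. 0 \<le> t \<Longrightarrow> c \<in> C \<Longrightarrow> z \<le> norm (x + t *\<^sub>R c) - t * d" for x z
    unfolding p_def using that by (intro cINF_greatest[OF I]) (auto simp: I_def g_def)
  obtain c0 where c0: "c0 \<in> C" using False by auto
  have pn: "p x \<le> norm x" for x using le[of 0 c0 x] c0 by simp
  have "sublinear p"
  proof (rule sublinearI)
    fix x y
    have "p (x + y) - (norm (x + s *\<^sub>R a) - s * d) \<le> p y" if s: "0 \<le> s" "a \<in> C" for s a
    proof (rule ge)
      fix t :: real and b assume t: "0 \<le> t" "b \<in> C"
      show "p (x + y) - (norm (x + s *\<^sub>R a) - s * d) \<le> norm (y + t *\<^sub>R b) - t * d"
      proof (cases "s + t = 0")
        case True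
        then have "s = 0" "t = 0" using s t by auto
        then show ?thesis using pn[of "x + y"] norm_triangle_ineq[of x y] by simp
      next
        case False
        \<comment> \<open>The weighted mean satisfies
          \<open>(s + t) *\<^sub>R c = s *\<^sub>R a + t *\<^sub>R b\<close>; this is where
          convexity of \<open>C\<close> enters.\<close>
        define c where "c = (s / (s + t)) *\<^sub>R a + (t / (s + t)) *\<^sub>R b"
        have st: "0 < s + t" using False s t by simp
        have "c \<in> C" unfolding c_def
          by (rule convexD[OF assms(1) s(2) t(2)]) (use s t st in \<open>auto simp: add_divide_distrib[symmetric]\<close>)
        then have "p (x + y) \<le> norm (x + y + (s + t) *\<^sub>R c) - (s + t) * d" using st by (intro le) auto
        moreover have "(s + t) *\<^sub>R c = s *\<^sub>R a + t *\<^sub>R b"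
          using st by (simp add: c_def scaleR_right_distrib)
        moreover have "norm (x + y + (s *\<^sub>R a + t *\<^sub>R b)) \<le> norm (x + s *\<^sub>R a) + norm (y + t *\<^sub>R b)"
          using norm_triangle_ineq[of "x + s *\<^sub>R a" "y + t *\<^sub>R b"] by (simp add: algebra_simps)
        ultimately show ?thesis by (simp add: algebra_simps)
      qed
    qed
    then have "p (x + y) - p y \<le> p x" by (intro ge) (simp add: algebra_simps)
    then show "p (x + y) \<le> p x + p y" by simp
  next
    fix c :: real and x assume c: "0 < c"
    have "p (c *\<^sub>R x) / c \<le> p x"
    proof (rule ge)
      fix t :: real and b assume t: "0 \<le> t" "b \<in> C"
      have "p (c *\<^sub>R x) \<le> norm (c *\<^sub>R x + (c * t) *\<^sub>R b) - (c * t) * d" using c t by (intro le) auto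
      also have "norm (c *\<^sub>R x + (c * t) *\<^sub>R b) = c * norm (x + t *\<^sub>R b)"
        using c by (simp flip: scaleR_scaleR scaleR_right_distrib)
      finally show "p (c *\<^sub>R x) / c \<le> norm (x + t *\<^sub>R b) - t * d" using c by (simp add: field_simps)
    qed
    then show "p (c *\<^sub>R x) \<le> c * p x" using c by (simp add: field_simps)
  next
    show "p 0 = 0"
    proof (rule antisym)
      show "p 0 \<le> 0" using pn[of 0] by simp
      show "0 \<le> p 0" using assms(2) by (intro ge) (simp add: mult_left_mono)
    qed
  qed
  then obtain F :: "'a \<Rightarrow>\<^sub>L real" where F: "norm F \<le> 1" "\<And>x. F x \<le> p x"
    using hahn_banach_blinfun pn by metis
  \<comment> \<open>At the point \<open>- c\<close> the choice \<open>t = 1\<close> makes the norm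
    vanish, so \<open>F (- c) \<le> - d\<close>.\<close>
  have "d \<le> F c" if "c \<in> C" for c
    using F(2)[of "- c"] le[of 1 c "- c"] that by (simp add: blinfun.minus_right)
  with F(1) show ?thesis by (rule that)
qed

lemma norming_functional:
  fixes x :: "'a::real_normed_vector"
  obtains F :: "'a \<Rightarrow>\<^sub>L real" where "norm F \<le> 1" "norm x \<le> F x"
  using separate_convex_from_0[of "{x}" "norm x"] by auto

section \<open>The weak topology and Mazur's theorem\<close>

lemma topspace_weak_topology [simp]: "topspace weak_topology = UNIV"
proof -
  have "(\<lambda>_. 0) -` (UNIV :: real set) \<in> {\<phi> -` U |(\<phi> :: 'a \<Rightarrow> real) U. bounded_linear \<phi> \<and> open U}"
    using bounded_linear_zero open_UNIV by blast
  then show ?thesis by (auto simp: weak_topology_def topology_generated_by_topspace)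
qed

lemma openin_weak_vimage:
  fixes \<phi> :: "'a::real_normed_vector \<Rightarrow> real"
  assumes "bounded_linear \<phi>" "open U"
  shows "openin weak_topology (\<phi> -` U)"
proof -
  have "\<exists>\<psi> W. \<phi> -` U = \<psi> -` W \<and> bounded_linear \<psi> \<and> open (W :: real set)"
    by (rule exI[of _ \<phi>], rule exI[of _ U]) (use assms in simp)
  then show ?thesis
    unfolding weak_topology_def by (intro topology_generated_by_Basis CollectI)
qed

lemma continuous_map_weak_topology:
  fixes g :: "'x \<Rightarrow> 'b::real_normed_vector"
  assumes "\<And>\<phi>. bounded_linear \<phi> \<Longrightarrow> continuous_map X euclideanreal (\<lambda>x. \<phi> (g x))"
  shows "continuous_map X weak_topology g"
  unfolding weak_topology_def
proof (rule continuous_on_generated_topo)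
  fix A :: "'b set"
  assume "A \<in> {\<phi> -` U |\<phi> U. bounded_linear \<phi> \<and> open (U :: real set)}"
  then obtain \<phi> U where A: "A = \<phi> -` U" "bounded_linear \<phi>" "open (U :: real set)" by auto
  have "openin X {x \<in> topspace X. \<phi> (g x) \<in> U}"
    using openin_continuous_map_preimage[OF assms[OF A(2)], of U] A(3) by simp
  also have "{x \<in> topspace X. \<phi> (g x) \<in> U} = g -` A \<inter> topspace X" by (auto simp: A)
  finally show "openin X (g -` A \<inter> topspace X)" .
next
  have "UNIV \<in> {\<phi> -` U |(\<phi> :: 'b \<Rightarrow> real) U. bounded_linear \<phi> \<and> open U}"
    using bounded_linear_zero open_UNIV by blast
  then show "g ` topspace X \<subseteq> \<Union> {\<phi> -` U |\<phi> U. bounded_linear \<phi> \<and> open (U :: real set)}" by auto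
qed

lemma continuous_map_bounded_linear_weak:
  "bounded_linear \<phi> \<Longrightarrow> continuous_map weak_topology euclideanreal \<phi>"
  unfolding continuous_map_alt by (auto simp: openin_weak_vimage)

lemma Hausdorff_weak_topology: "Hausdorff_space (weak_topology :: 'a::real_normed_vector topology)"
  unfolding Hausdorff_space_def
proof (intro allI impI)
  fix x y :: 'a
  assume "x \<in> topspace weak_topology \<and> y \<in> topspace weak_topology \<and> x \<noteq> y"
  then have xy: "x \<noteq> y" by simp
  obtain F :: "'a \<Rightarrow>\<^sub>L real" where F: "norm (x - y) \<le> F (x - y)" using norming_functional by metis
  then have "0 < F (x - y)" using xy by (auto intro: less_le_trans[of 0 "norm (x - y)"])
  then have lt: "F y < F x" by (simp add: blinfun.diff_right)
  define m where "m = (F x + F y) / 2"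
  have *: "bounded_linear (blinfun_apply F)" by (rule blinfun.bounded_linear_right)
  show "\<exists>U V. openin weak_topology U \<and> openin weak_topology V \<and> x \<in> U \<and> y \<in> V \<and> disjnt U V"
    using lt openin_weak_vimage[OF *, of "{m<..}"] openin_weak_vimage[OF *, of "{..<m}"]
    by (intro exI[of _ "blinfun_apply F -` {m<..}"] exI[of _ "blinfun_apply F -` {..<m}"])
       (auto simp: disjnt_def m_def)
qed

text \<open>The hypothesis says that no functional strictly separates \<open>x\<close> from
  \<open>C\<close>. It is one-sided so that it can be checked for weak closure points and equally
  for a point known only through approximations on finitely many functionals. A positive distance
  \<open>e\<close> would give, by separating \<open>C - x\<close> from \<open>0\<close>, a
  functional with \<open>F x + e \<le> F c\<close> on \<open>C\<close>.\<close>

lemma mazur: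
  fixes C :: "'a::real_normed_vector set"
  assumes "convex C"
    and "\<And>F :: 'a \<Rightarrow>\<^sub>L real. \<And>e. 0 < e \<Longrightarrow> \<exists>c\<in>C. F c < F x + e"
  shows "x \<in> closure C"
proof (rule ccontr)
  assume "x \<notin> closure C"
  then obtain e where e: "0 < e" "\<And>c. c \<in> C \<Longrightarrow> e \<le> dist c x"
    unfolding closure_approachable by (auto simp: not_less)
  have "convex ((\<lambda>c. c - x) ` C)" using convex_translation_subtract[OF assms(1)] by simp
  then obtain F :: "'a \<Rightarrow>\<^sub>L real" where "\<And>c. c \<in> (\<lambda>c. c - x) ` C \<Longrightarrow> e \<le> F c"
    by (rule separate_convex_from_0[of "(\<lambda>c. c - x) ` C" e]) (use e(2) in \<open>auto simp: dist_norm\<close>)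
  then have "\<And>c. c \<in> C \<Longrightarrow> F x + e \<le> F c" by (fastforce simp: blinfun.diff_right)
  with assms(2)[OF e(1), of F] show False by (auto simp: not_less dest: leD)
qed

lemma weak_closure_approx:
  assumes "x \<in> weak_topology closure_of D" "bounded_linear \<phi>" "0 < (e::real)"
  shows "\<exists>d\<in>D. \<phi> d < \<phi> x + e"
proof -
  have "x \<in> \<phi> -` {..<\<phi> x + e}" "openin weak_topology (\<phi> -` {..<\<phi> x + e})"
    using assms by (auto intro: openin_weak_vimage)
  then obtain d where "d \<in> D" "d \<in> \<phi> -` {..<\<phi> x + e}"
    using in_closure_of[THEN iffD1, OF assms(1)] by meson
  then show ?thesis by auto
qed

section \<open>Simons' inequality and Krein's theorem\<close>

text \<open>Simons' inequality: with \<open>p g = Max (g ` K)\<close>, the near-minimal choices \<open>g n\<close> make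
  \<open>p (\<Sum>k. g k / 2^(k+1))\<close> exceed the value of \<open>p\<close> at the \<open>n\<close>-th partial sum by a fixed proportion of
  \<open>2^-n\<close>, so at a point where the full sum attains its maximum over \<open>K\<close> infinitely many \<open>g k\<close> are large.\<close>

lemma simons:
  fixes G :: "nat \<Rightarrow> 'a::real_normed_vector \<Rightarrow>\<^sub>L real"
  assumes bounded: "bounded K"
    and attained: "\<And>g :: 'a \<Rightarrow>\<^sub>L real. \<exists>b\<in>K. \<forall>c\<in>K. g c \<le> g b"
    and G: "\<And>n. norm (G n) \<le> M"
    and e: "0 < e" and large: "\<And>g. g \<in> convex hull (range G) \<Longrightarrow> \<exists>b\<in>K. e \<le> g b"
  obtains b where "b \<in> K" "\<And>n. \<exists>m\<ge>n. e / 4 \<le> G m b"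
proof -
  \<comment> \<open>Hulls of tails: an upper bound for \<open>G m b\<close> valid for all
    \<open>m \<ge> n\<close> is inherited by every element of \<open>C n\<close>, hence by all terms
    chosen from stage \<open>n\<close> on.\<close>
  define C where "C n = convex hull (G ` {n..})" for n
  have C_convex: "convex (C n)" for n unfolding C_def by (rule convex_convex_hull)
  have C_mono: "C n \<subseteq> C m" if "m \<le> n" for m n
    unfolding C_def by (rule hull_mono) (use that in auto)
  have C0: "C 0 = convex hull (range G)" by (simp add: C_def atLeast_0)
  have GC: "G n \<in> C n" for n unfolding C_def by (intro hull_inc) auto
  have C_norm: "norm g \<le> M" if "g \<in> C n" for g n
  proof -
    have "C n \<subseteq> cball 0 M" unfolding C_def by (rule hull_minimal) (use G in auto)
    then show ?thesis using that by auto
  qed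
  obtain R where R: "0 < R" "\<And>c. c \<in> K \<Longrightarrow> norm c \<le> R"
    using bounded unfolding bounded_pos by auto
  define p where "p g = (SUP c\<in>K. blinfun_apply g c)" for g :: "'a \<Rightarrow>\<^sub>L real"
  have p_att: "\<exists>b\<in>K. p g = g b \<and> (\<forall>c\<in>K. g c \<le> g b)" for g :: "'a \<Rightarrow>\<^sub>L real"
  proof -
    obtain b where b: "b \<in> K" "\<forall>c\<in>K. g c \<le> g b" using attained by blast
    then have "p g = g b" unfolding p_def by (intro cSup_eq_maximum) auto
    with b show ?thesis by auto
  qed
  have p_upper: "g c \<le> p g" if "c \<in> K" for g :: "'a \<Rightarrow>\<^sub>L real" and c using p_att[of g] that by auto
  have p_add: "p (g + h) \<le> p g + p h" for g h
    using p_att[of "g + h"] by (auto simp: blinfun.add_left intro!: add_mono p_upper)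
  have p_scale: "p (c *\<^sub>R g) \<le> c * p g" if "0 \<le> c" for c g
    using p_att[of "c *\<^sub>R g"] that by (auto simp: blinfun.scaleR_left intro!: mult_left_mono p_upper)
  have p_le: "p g \<le> norm g * R" for g
  proof -
    obtain b where b: "b \<in> K" "p g = g b" using p_att by blast
    have "g b \<le> norm (g b)" by simp
    also have "\<dots> \<le> norm g * norm b" by (rule norm_blinfun)
    also have "\<dots> \<le> norm g * R" using R(2)[OF b(1)] by (simp add: mult_left_mono)
    finally show ?thesis by (simp add: b)
  qed
  have p_lip: "p g \<le> p h + norm (g - h) * R" for g h
    using p_add[of h "g - h"] p_le[of "g - h"] by simp
  have p_tendsto: "(\<lambda>n. p (u n)) \<longlonglongrightarrow> p l" if "u \<longlonglongrightarrow> l" for u l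
  proof (rule LIM_zero_cancel, rule Lim_null_comparison)
    show "\<forall>\<^sub>F n in sequentially. norm (p (u n) - p l) \<le> norm (u n - l) * R"
    proof (rule always_eventually, rule allI)
      fix n show "norm (p (u n) - p l) \<le> norm (u n - l) * R"
        using p_lip[of "u n" l] p_lip[of l "u n"] by (simp add: norm_minus_commute abs_le_iff)
    qed
    have "(\<lambda>n. norm (u n - l) * R) \<longlonglongrightarrow> 0 * R"
      by (intro tendsto_mult_right tendsto_norm_zero LIM_zero that)
    then show "(\<lambda>n. norm (u n - l) * R) \<longlonglongrightarrow> 0" by simp
  qed
  have large': "e \<le> p g" if "g \<in> C 0" for g
    using large[of g] that p_upper[of _ g] by (force simp: C0)

  \<comment> \<open>The errors decay like \<open>4^-n\<close> against weights \<open>2^-n\<close>.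
    The constant \<open>e / 8\<close> is the one for which the induction proving \<open>gap\<close>
    closes with equality.\<close>
  define \<eta> where "\<eta> n = e / 8 * (1/4) ^ n" for n :: nat
  have near_min: "\<exists>g\<in>C n. \<forall>h\<in>C n. p (s + (1/2)^n *\<^sub>R g) \<le> p (s + (1/2)^n *\<^sub>R h) + \<eta> n" for n s
  proof -
    let ?q = "\<lambda>g. p (s + (1/2)^n *\<^sub>R g)"
    have "bdd_below (?q ` C n)"
    proof (rule bdd_belowI2)
      fix g assume g: "g \<in> C n"
      have "p 0 \<le> ?q g + p (- (s + (1/2)^n *\<^sub>R g))" using p_add[of "s + (1/2)^n *\<^sub>R g" "- (s + (1/2)^n *\<^sub>R g)"] by simp
      moreover have "p (- (s + (1/2)^n *\<^sub>R g)) \<le> (norm s + M) * R"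
      proof (rule order_trans[OF p_le])
        have "norm (s + (1/2)^n *\<^sub>R g) \<le> norm s + norm ((1/2)^n *\<^sub>R g)" by (rule norm_triangle_ineq)
        also have "norm ((1/2)^n *\<^sub>R g) = (1/2)^n * norm g" by simp
        also have "\<dots> \<le> 1 * norm g" by (intro mult_right_mono) (auto simp: power_le_one)
        also have "norm g \<le> M" by (rule C_norm[OF g])
        finally show "norm (- (s + (1/2)^n *\<^sub>R g)) * R \<le> (norm s + M) * R"
          using R(1) unfolding norm_minus_cancel by (intro mult_right_mono) auto
      qed
      ultimately show "p 0 - (norm s + M) * R \<le> ?q g" by linarith
    qed
    moreover have "C n \<noteq> {}" using GC by auto
    moreover have "0 < \<eta> n" using e by (simp add: \<eta>_def)
    ultimately obtain g where g: "g \<in> C n" "?q g < (INF g\<in>C n. ?q g) + \<eta> n"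
      using cINF_less_iff[of "C n" ?q "(INF g\<in>C n. ?q g) + \<eta> n"] by auto
    moreover have "(INF g\<in>C n. ?q g) \<le> ?q h" if "h \<in> C n" for h
      by (rule cINF_lower) (fact+)
    ultimately show ?thesis by (intro bexI[of _ g] ballI) (auto intro: less_imp_le[OF less_le_trans])
  qed
  define \<gamma> where "\<gamma> n s = (SOME g. g \<in> C n \<and> (\<forall>h\<in>C n. p (s + (1/2)^n *\<^sub>R g) \<le> p (s + (1/2)^n *\<^sub>R h) + \<eta> n))"
    for n s
  have \<gamma>: "\<gamma> n s \<in> C n" "\<And>h. h \<in> C n \<Longrightarrow> p (s + (1/2)^n *\<^sub>R \<gamma> n s) \<le> p (s + (1/2)^n *\<^sub>R h) + \<eta> n" for n s
    using someI_ex[OF near_min[of n s, unfolded Bex_def]] unfolding \<gamma>_def[symmetric] by auto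
  \<comment> \<open>\<open>g n\<close> was chosen with weight \<open>(1/2)^n\<close>, which is the
    total weight of the series from stage \<open>n\<close> on, but it enters the sum with only half
    of it.\<close>
  define S where "S = rec_nat (0 :: 'a \<Rightarrow>\<^sub>L real) (\<lambda>n s. s + (1/2)^(Suc n) *\<^sub>R \<gamma> n s)"
  have S_0: "S 0 = 0" and S_Suc: "S (Suc n) = S n + (1/2)^(Suc n) *\<^sub>R \<gamma> n (S n)" for n
    by (simp_all add: S_def)
  define g where "g n = \<gamma> n (S n)" for n
  have gC: "g n \<in> C n" for n by (simp add: g_def \<gamma>)
  have g_min: "h \<in> C n \<Longrightarrow> p (S n + (1/2)^n *\<^sub>R g n) \<le> p (S n + (1/2)^n *\<^sub>R h) + \<eta> n" for n h
    by (simp add: g_def \<gamma>)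
  have S_Suc': "S (Suc n) = S n + (1/2)^(Suc n) *\<^sub>R g n" for n by (simp add: S_Suc g_def)

  \<comment> \<open>Any candidate \<open>h\<close> for stage \<open>Suc n\<close> becomes, averaged
    with \<open>g n\<close>, a candidate for stage \<open>n\<close>. This compares consecutive
    near-minima and keeps all candidates inside \<open>C 0\<close>.\<close>
  have step: "S (Suc n) + (1/2)^(Suc n) *\<^sub>R h = S n + (1/2)^n *\<^sub>R ((1/2) *\<^sub>R g n + (1/2) *\<^sub>R h)" for n h
    by (simp add: S_Suc' scaleR_right_distrib)
  have mid: "(1/2) *\<^sub>R a + (1/2) *\<^sub>R b \<in> C n" if "a \<in> C n" "b \<in> C n" for a b n
    by (rule convexD[OF C_convex that]) auto
  have in_C0: "h \<in> C 0 \<Longrightarrow> S n + (1/2)^n *\<^sub>R h \<in> C 0" for n h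
  proof (induction n arbitrary: h)
    case (Suc n)
    have "g n \<in> C 0" using gC C_mono[of 0 n] by auto
    then show ?case unfolding step by (intro Suc.IH mid Suc.prems)
  qed (simp add: S_0)

  have "summable (\<lambda>n. (1/2)^(Suc n) *\<^sub>R g n)"
  proof (rule summable_comparison_test')
    show "summable (\<lambda>n. (1/2)^(Suc n) * M)" by (intro summable_mult2) (simp add: summable_geometric)
    show "norm ((1/2)^(Suc n) *\<^sub>R g n) \<le> (1/2)^(Suc n) * M" for n
      using C_norm[OF gC[of n]] by (simp add: mult_left_mono)
  qed
  then obtain s where s: "(\<lambda>n. \<Sum>k<n. (1/2)^(Suc k) *\<^sub>R g k) \<longlonglongrightarrow> s"
    unfolding summable_def sums_def by auto
  have S_eq: "S n = (\<Sum>k<n. (1/2)^(Suc k) *\<^sub>R g k)" for n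
    by (induction n) (simp_all add: S_0 S_Suc' del: power_Suc)
  have S_lim: "S \<longlonglongrightarrow> s" using s by (simp add: S_eq[abs_def])

  define P where "P n = p (S n + (1/2)^n *\<^sub>R g n)" for n
  have P_lim: "P \<longlonglongrightarrow> p s"
  proof -
    have "(\<lambda>n. (1/2)^n *\<^sub>R g n) \<longlonglongrightarrow> 0"
    proof (rule Lim_null_comparison)
      show "\<forall>\<^sub>F n in sequentially. norm ((1/2)^n *\<^sub>R g n) \<le> (1/2)^n * M"
        using C_norm[OF gC] by (intro always_eventually allI) (simp add: mult_left_mono)
      show "(\<lambda>n. (1/2)^n * M) \<longlonglongrightarrow> 0" by (intro tendsto_mult_left_zero LIMSEQ_power_zero) simp
    qed
    then have "(\<lambda>n. S n + (1/2)^n *\<^sub>R g n) \<longlonglongrightarrow> s + 0" by (intro tendsto_add S_lim)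
    then show ?thesis unfolding P_def by (intro p_tendsto) simp
  qed
  have P_e: "e \<le> P n" for n
    unfolding P_def using gC[of n] C_mono[of 0 n] by (intro large' in_C0) auto
  have P_step: "P n \<le> P (Suc n) + \<eta> n" for n
  proof -
    have "g (Suc n) \<in> C n" using gC[of "Suc n"] C_mono[of n "Suc n"] by auto
    then have "P n \<le> p (S n + (1/2)^n *\<^sub>R ((1/2) *\<^sub>R g n + (1/2) *\<^sub>R g (Suc n))) + \<eta> n"
      unfolding P_def by (intro g_min mid gC)
    then show ?thesis unfolding P_def step .
  qed
  \<comment> \<open>The errors from stage \<open>n\<close> on add up to
    \<open>4/3 * \<eta> n\<close>, so the correction by \<open>2 * \<eta> n\<close> makes
    \<open>P\<close> increasing and its limit an upper bound.\<close>
  have "incseq (\<lambda>n. P n - 2 * \<eta> n)"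
  proof (rule incseq_SucI)
    fix n
    have "0 \<le> \<eta> n" using e by (simp add: \<eta>_def)
    moreover have "\<eta> (Suc n) = \<eta> n / 4" by (simp add: \<eta>_def)
    ultimately show "P n - 2 * \<eta> n \<le> P (Suc n) - 2 * \<eta> (Suc n)" using P_step[of n] by simp
  qed
  moreover have "(\<lambda>n. P n - 2 * \<eta> n) \<longlonglongrightarrow> p s - 2 * 0"
    unfolding \<eta>_def by (intro tendsto_intros P_lim tendsto_mult_right_zero LIMSEQ_power_zero) simp
  ultimately have "P n - 2 * \<eta> n \<le> p s - 2 * 0" for n by (rule incseq_le)
  then have P_le: "P n \<le> p s + 2 * \<eta> n" for n by (simp add: algebra_simps)
  have ps: "e \<le> p s" using P_lim P_e by (intro LIMSEQ_le_const) auto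

  \<comment> \<open>\<open>S (Suc n)\<close> is the midpoint of \<open>S n\<close> and the point at
    which \<open>P n\<close> is taken, so each step halves the gap up to the error
    \<open>\<eta> n\<close>. The summand of order \<open>4^-n\<close> is present to absorb that
    error.\<close>
  have gap: "(1/2)^n * (e / 2 + e / 2 * (1/2)^n) \<le> p s - p (S n)" for n
  proof (induction n)
    case 0
    have "p 0 \<le> 0" using p_scale[of 0 0] by simp
    then show ?case using ps by (simp add: S_0)
  next
    case (Suc n)
    have "S (Suc n) = (1/2) *\<^sub>R S n + (1/2) *\<^sub>R (S n + (1/2)^n *\<^sub>R g n)"
      by (simp add: S_Suc' scaleR_right_distrib scaleR_half_double flip: scaleR_left_distrib)
    then have "p (S (Suc n)) \<le> 1/2 * p (S n) + 1/2 * P n"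
      unfolding P_def using p_add[of "(1/2) *\<^sub>R S n" "(1/2) *\<^sub>R (S n + (1/2)^n *\<^sub>R g n)"]
        p_scale[of "1/2" "S n"] p_scale[of "1/2" "S n + (1/2)^n *\<^sub>R g n"] by simp
    then have "1/2 * (p s - p (S n)) - \<eta> n \<le> p s - p (S (Suc n))"
      using P_le[of n] by (simp only: right_diff_distrib)
    from order_trans[OF diff_right_mono[OF mult_left_mono[OF Suc.IH, of "1/2"]] this]
    have "1/2 * ((1/2)^n * (e / 2 + e / 2 * (1/2)^n)) - \<eta> n \<le> p s - p (S (Suc n))" by simp
    moreover have "\<eta> n = e / 8 * ((1/2)^n * (1/2)^n)" by (simp add: \<eta>_def flip: power_mult_distrib)
    ultimately show ?case by (simp add: algebra_simps)
  qed

  \<comment> \<open>If \<open>G m b\<close> stayed below \<open>e / 4\<close> from \<open>n\<close>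
    on, the rest of the series would contribute at most \<open>2^-n * e / 4\<close> at
    \<open>b\<close>, whereas \<open>p (S n)\<close> lies below \<open>p s = s b\<close> by more
    than \<open>2^-n * e / 2\<close>.\<close>
  obtain b where b: "b \<in> K" "p s = s b" using p_att by blast
  have "\<exists>m\<ge>n. e / 4 \<le> G m b" for n
  proof (rule ccontr)
    assume "\<not> (\<exists>m\<ge>n. e / 4 \<le> G m b)"
    then have "G ` {n..} \<subseteq> {h. blinfun_apply h b \<le> e / 4}" by fastforce
    moreover have "convex ((\<lambda>h. blinfun_apply h b) -` {..e / 4})"
      by (intro convex_linear_vimage bounded_linear.linear blinfun.bounded_linear_left) simp
    then have "convex {h. blinfun_apply h b \<le> e / 4}" by (simp add: vimage_def)
    ultimately have "C n \<subseteq> {h. blinfun_apply h b \<le> e / 4}" unfolding C_def by (rule hull_minimal)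
    then have gb: "g m b \<le> e / 4" if "n \<le> m" for m using gC[of m] C_mono[OF that] by auto
    have "S (n + i) b - S n b \<le> ((1/2)^n - (1/2)^(n + i)) * (e / 4)" for i
    proof (induction i)
      case (Suc i)
      have "S (n + Suc i) b = S (n + i) b + (1/2)^(Suc (n + i)) * g (n + i) b"
        by (simp add: S_Suc' blinfun.add_left blinfun.scaleR_left del: power_Suc)
      also have "\<dots> \<le> S (n + i) b + (1/2)^(Suc (n + i)) * (e / 4)"
        using gb[of "n + i"] by (simp add: mult_left_mono)
      finally show ?case using Suc.IH by (simp add: algebra_simps)
    qed simp
    moreover have "((1/2)^n - (1/2)^(n + i)) * (e / 4) \<le> (1/2)^n * (e / 4)" for i :: nat
      using e by (intro mult_right_mono) auto
    ultimately have "S (n + i) b \<le> S n b + (1/2)^n * (e / 4)" for i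
      by (smt (verit))
    moreover have "(\<lambda>i. S (n + i) b) \<longlonglongrightarrow> s b"
      using LIMSEQ_ignore_initial_segment[OF S_lim, of n]
      by (intro blinfun.tendsto tendsto_const) (simp_all add: add.commute)
    ultimately have "s b \<le> S n b + (1/2)^n * (e / 4)" by (intro LIMSEQ_le_const2) auto
    also have "S n b \<le> p (S n)" by (rule p_upper[OF b(1)])
    also have "p (S n) \<le> p s - (1/2)^n * (e / 2 + e / 2 * (1/2)^n)" using gap[of n] by simp
    finally have "(1/2)^n * (e / 2 + e / 2 * (1/2)^n) \<le> (1/2)^n * (e / 4)" using b(2) by simp
    then have "e / 2 + e / 2 * (1/2)^n \<le> e / 4" by (rule mult_left_le_imp_le) simp
    moreover have "0 < e / 2 * (1/2)^n" using e by simp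
    ultimately show False using e by linarith
  qed
  with b(1) show ?thesis by (rule that)
qed

section \<open>Helly's theorem and Krein's theorem\<close>

text \<open>Induction on \<open>X\<close>, over all subspaces \<open>M\<close> so that one can pass
  to the kernel of a new point \<open>x\<close>. As in a one-step Hahn-Banach extension, a number
  \<open>a\<close> must be found between all \<open>l F - d * norm F\<close> and all
  \<open>l G + d * norm G\<close> with \<open>F\<close> and \<open>G\<close> equal to
  \<open>1\<close> at \<open>x\<close>; it exists because \<open>F - G\<close> vanishes at
  \<open>x\<close>, where the bound is already known.\<close>

lemma helly:
  fixes L :: "('a::real_normed_vector \<Rightarrow>\<^sub>L real) \<Rightarrow> real"
  assumes "finite X" "linear L" "subspace M" "0 \<le> d"
    and "\<And>F. F \<in> M \<Longrightarrow> (\<And>x. x \<in> X \<Longrightarrow> blinfun_apply F x = 0) \<Longrightarrow> L F \<le> d * norm F"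
  shows "\<exists>z. \<forall>F\<in>M. L F - blinfun_apply F z \<le> d * norm F"
  using assms(1,3,5)
proof (induction X arbitrary: M)
  case empty
  then show ?case by (intro exI[of _ 0]) simp
next
  case (insert x X)
  define M' where "M' = M \<inter> {F. blinfun_apply F x = 0}"
  have "subspace M'" unfolding M'_def
    by (intro subspace_inter insert.prems(1)) (auto simp: subspace_def blinfun.add_left blinfun.scaleR_left)
  then have "\<exists>z. \<forall>F\<in>M'. L F - blinfun_apply F z \<le> d * norm F"
    by (rule insert.IH) (use insert.prems(2) in \<open>auto simp: M'_def\<close>)
  then obtain z where z: "\<And>F. F \<in> M \<Longrightarrow> blinfun_apply F x = 0 \<Longrightarrow> L F - blinfun_apply F z \<le> d * norm F"
    by (auto simp: M'_def)
  define l where "l F = L F - blinfun_apply F z" for F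
  have l: "linear l" unfolding l_def
    by (rule linearI) (simp_all add: linear_add[OF assms(2)] linear_scale[OF assms(2)]
        blinfun.add_left blinfun.scaleR_left algebra_simps)
  define A where "A = {F \<in> M. blinfun_apply F x = 1}"
  define a where "a = (SUP F\<in>A. l F - d * norm F)"
  have l_le: "l F \<le> d * norm F" if "F \<in> M" "blinfun_apply F x = 0" for F
    unfolding l_def by (rule z[OF that])
  have scale: "(1 / blinfun_apply F x) *\<^sub>R F \<in> A" if "F \<in> M" "blinfun_apply F x \<noteq> 0" for F
    using that insert.prems(1) by (auto simp: A_def blinfun.scaleR_left subspace_scale)
  show ?case
  proof (cases "A = {}")
    case True
    then have "blinfun_apply F x = 0" if "F \<in> M" for F using scale[OF that] by auto
    then show ?thesis using z by blast
  next
    case False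
    have cmp: "l F - d * norm F \<le> l G + d * norm G" if "F \<in> A" "G \<in> A" for F G
    proof -
      have "l (F - G) \<le> d * norm (F - G)"
        by (rule l_le) (use that insert.prems(1) in \<open>auto simp: A_def blinfun.diff_left subspace_diff\<close>)
      also have "\<dots> \<le> d * norm F + d * norm G"
        using mult_left_mono[OF norm_triangle_ineq4[of F G] assms(4)] by (simp add: distrib_left)
      finally show ?thesis by (simp add: linear_diff[OF l])
    qed
    obtain G where G: "G \<in> A" using False by auto
    have lower: "l F - d * norm F \<le> a" if "F \<in> A" for F
      unfolding a_def by (rule cSUP_upper[OF that]) (rule bdd_aboveI2[of _ _ "l G + d * norm G"], rule cmp[OF _ G])
    have upper: "a \<le> l F + d * norm F" if "F \<in> A" for F
      unfolding a_def by (rule cSUP_least[OF False]) (rule cmp[OF _ that])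
    have "l F - a * blinfun_apply F x \<le> d * norm F" if F: "F \<in> M" for F
    proof (cases "blinfun_apply F x = 0")
      case True
      then show ?thesis using l_le[OF F] by simp
    next
      case nz: False
      define t where "t = blinfun_apply F x"
      have FA: "(1 / t) *\<^sub>R F \<in> A" using scale[OF F] nz by (simp add: t_def)
      have lt: "l ((1 / t) *\<^sub>R F) = l F / t" using linear_scale[OF l] by simp
      show ?thesis
      proof (cases "0 < t")
        case True
        then show ?thesis using lower[OF FA] by (simp add: lt t_def[symmetric] field_simps)
      next
        case False
        then have "t < 0" using nz by (simp add: t_def)
        then show ?thesis using upper[OF FA] by (simp add: lt t_def[symmetric] field_simps)
      qed
    qed
    then show ?thesis
      by (intro exI[of _ "z + a *\<^sub>R x"]) (auto simp: l_def blinfun.add_right blinfun.scaleR_right algebra_simps)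
  qed
qed

lemma convex_hull_finite_subset:
  assumes "w \<in> convex hull K"
  obtains T where "finite T" "T \<subseteq> K" "w \<in> convex hull T"
proof -
  obtain T u where "finite T" "T \<subseteq> K" "\<forall>x\<in>T. 0 \<le> u x" "sum u T = 1" "(\<Sum>v\<in>T. u v *\<^sub>R v) = w"
    using assms unfolding convex_hull_explicit by blast
  then show ?thesis by (intro that[of T]) (auto simp: convex_hull_finite)
qed

lemma convex_hull_blinfun_less:
  assumes "w \<in> convex hull D" "z \<le> blinfun_apply g w"
  shows "\<exists>d\<in>D. z \<le> blinfun_apply (g :: 'a::real_normed_vector \<Rightarrow>\<^sub>L real) d"
proof (rule ccontr)
  assume "\<not> (\<exists>d\<in>D. z \<le> blinfun_apply g d)"
  then have "D \<subseteq> {x. blinfun_apply g x < z}" by (auto simp: not_le)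
  moreover have "convex {x. blinfun_apply g x < z}"
    by (auto simp: convex_def blinfun.add_right blinfun.scaleR_right intro: convex_bound_lt)
  ultimately have "convex hull D \<subseteq> {x. blinfun_apply g x < z}" by (rule hull_minimal)
  with assms show False by auto
qed

text \<open>A generalised limit: a linear functional below the sublinear map that takes
  \<open>x\<close> to the limit superior of \<open>F n x\<close>. Where the limit exists, the bounds
  at \<open>x\<close> and \<open>- x\<close> force equality. It replaces a weak-star limit of the
  sequence.\<close>

lemma limsup_functional:
  fixes F :: "nat \<Rightarrow> 'a::real_normed_vector \<Rightarrow>\<^sub>L real"
  assumes "\<And>n. norm (F n) \<le> 1"
  obtains H :: "'a \<Rightarrow>\<^sub>L real" where "norm H \<le> 1"
    "\<And>x l. (\<lambda>n. F n x) \<longlonglongrightarrow> l \<Longrightarrow> H x = l"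
proof -
  have bd: "\<bar>F n x\<bar> \<le> norm x" for n x
    using norm_blinfun[of "F n" x] mult_right_mono[OF assms[of n], of "norm x"] by simp
  define T where "T n x = (SUP k\<in>{n..}. F k x)" for n x
  have bdda: "bdd_above ((\<lambda>k. F k x) ` {n..})" for n x
    by (rule bdd_aboveI2[of _ _ "norm x"]) (use bd abs_le_D1 in blast)
  have T_upper: "F k x \<le> T n x" if "n \<le> k" for k n x
    unfolding T_def by (rule cSUP_upper[OF _ bdda]) (use that in auto)
  have T_least: "T n x \<le> z" if "\<And>k. n \<le> k \<Longrightarrow> F k x \<le> z" for n x z
    unfolding T_def by (rule cSUP_least) (use that in auto)
  define p where "p x = (INF n. T n x)" for x
  have T_lower: "- norm x \<le> T n x" for n x
    using T_upper[of n n x] bd[of n x] by linarith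
  have bddb: "bdd_below (range (\<lambda>n. T n x))" for x
    by (rule bdd_belowI2[of _ "- norm x"]) (rule T_lower)
  have p_lower: "p x \<le> T n x" for n x unfolding p_def by (rule cINF_lower[OF bddb]) simp
  have p_great: "z \<le> p x" if "\<And>n. z \<le> T n x" for z x unfolding p_def by (rule cINF_greatest) (use that in auto)
  have T_mono: "T n x \<le> T m x" if "m \<le> n" for m n x
    by (rule T_least) (use that T_upper in force)
  have "sublinear p"
  proof (rule sublinearI)
    fix x y
    have "p (x + y) - T m x \<le> p y" for m
    proof (rule p_great)
      fix n
      define k where "k = max m n"
      have "T k (x + y) \<le> T k x + T k y"
        by (rule T_least) (auto simp: blinfun.add_right intro: add_mono T_upper)
      then show "p (x + y) - T m x \<le> T n y"
        using p_lower[of "x + y" k] T_mono[of m k x] T_mono[of n k y] by (simp add: k_def)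
    qed
    then have "p (x + y) - p y \<le> p x" by (intro p_great) (simp add: algebra_simps)
    then show "p (x + y) \<le> p x + p y" by simp
  next
    fix c :: real and x assume c: "0 < c"
    have "p (c *\<^sub>R x) / c \<le> p x"
    proof (rule p_great)
      fix n
      have "T n (c *\<^sub>R x) \<le> c * T n x"
        by (rule T_least) (use c T_upper in \<open>auto simp: blinfun.scaleR_right intro: mult_left_mono\<close>)
      then have "p (c *\<^sub>R x) \<le> c * T n x" using p_lower[of "c *\<^sub>R x" n] by simp
      then show "p (c *\<^sub>R x) / c \<le> T n x" using c by (simp add: field_simps)
    qed
    then show "p (c *\<^sub>R x) \<le> c * p x" using c by (simp add: field_simps)
  next
    have "T n 0 = 0" for n by (simp add: T_def)
    then show "p 0 = 0" by (simp add: p_def)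
  qed
  moreover have "p x \<le> norm x" for x
    using p_lower[of x 0] T_least[of 0 x "norm x"] bd[of _ x] by (meson abs_le_D1 order_trans)
  ultimately obtain H :: "'a \<Rightarrow>\<^sub>L real" where H: "norm H \<le> 1" "\<And>x. H x \<le> p x"
    using hahn_banach_blinfun by metis
  have upper: "H x \<le> l" if lim: "(\<lambda>n. F n x) \<longlonglongrightarrow> l" for x l
  proof (rule field_le_epsilon)
    fix e :: real assume "0 < e"
    then obtain n where "\<And>k. n \<le> k \<Longrightarrow> F k x \<le> l + e"
      using order_tendstoD(2)[OF lim, of "l + e"] by (force simp: eventually_sequentially)
    then have "T n x \<le> l + e" by (rule T_least)
    then show "H x \<le> l + e" using H(2)[of x] p_lower[of x n] by linarith
  qed
  show ?thesis
  proof (rule that[OF H(1)])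
    fix x l assume lim: "(\<lambda>n. F n x) \<longlonglongrightarrow> l"
    then have "(\<lambda>n. F n (- x)) \<longlonglongrightarrow> - l" by (simp add: blinfun.minus_right tendsto_minus)
    from upper[OF this] upper[OF lim] show "H x = l" by (simp add: blinfun.minus_right)
  qed
qed

text \<open>If \<open>L\<close> had distance more than \<open>d\<close> from every evaluation, one could choose points \<open>x n\<close> close to multiples of
  \<open>convex hull K\<close> and functionals \<open>F m\<close> with \<open>F m (x n) = 0\<close> for \<open>n < m\<close> and \<open>F m (x n) \<ge> 9 d / 10\<close> for
  \<open>m \<le> n\<close>. After subtracting a pointwise limit of a subsequence, this contradicts Simons' inequality.\<close>

lemma krein_approx:
  fixes L :: "('a::real_normed_vector \<Rightarrow>\<^sub>L real) \<Rightarrow> real"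
  assumes L: "linear L" and d: "0 < d"
    and K: "compactin weak_topology K" "bounded K"
    and r: "0 < r"
    and approx: "\<And>\<F> \<eta>. finite \<F> \<Longrightarrow> 0 < \<eta> \<Longrightarrow>
      \<exists>w\<in>convex hull K. \<exists>x. norm (x - r *\<^sub>R w) \<le> d / 10 \<and> (\<forall>F\<in>\<F>. \<bar>blinfun_apply F x - L F\<bar> < \<eta>)"
  shows "\<exists>z. \<forall>F. L F - blinfun_apply F z \<le> d * norm F"
proof (rule ccontr)
  assume far: "\<nexists>z. \<forall>F. L F - blinfun_apply F z \<le> d * norm F"
  \<comment> \<open>Helly's theorem read backwards: were \<open>L\<close> bounded by
    \<open>d\<close> on the functionals vanishing on \<open>X\<close>, some evaluation would be
    within \<open>d\<close> of it.\<close>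
  have ex_F: "\<exists>F. norm F = 1 \<and> d < L F \<and> (\<forall>x\<in>X. blinfun_apply F x = 0)" if "finite X" for X
  proof -
    have "\<not> (\<forall>F. (\<forall>x\<in>X. blinfun_apply F x = 0) \<longrightarrow> L F \<le> d * norm F)"
      using helly[OF that L subspace_UNIV, of d] far d by auto
    then obtain F where F: "\<And>x. x \<in> X \<Longrightarrow> blinfun_apply F x = 0" "d * norm F < L F" by (auto simp: not_le)
    have "F \<noteq> 0" using F(2) linear_0[OF L] by auto
    then have n: "0 < norm F" by simp
    have "d < L ((1 / norm F) *\<^sub>R F)" using F(2) n by (simp add: linear_scale[OF L] field_simps)
    then show ?thesis
      using n F(1) by (intro exI[of _ "(1 / norm F) *\<^sub>R F"]) (auto simp: blinfun.scaleR_left)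
  qed
  define Q where "Q f n = (\<lambda>(F :: 'a \<Rightarrow>\<^sub>L real, w, x). norm F = 1 \<and> d < L F \<and> (\<forall>i<n. blinfun_apply F (snd (snd (f i))) = 0) \<and>
      w \<in> convex hull K \<and> norm (x - r *\<^sub>R w) \<le> d / 10 \<and> \<bar>blinfun_apply F x - L F\<bar> < d / 10 \<and>
      (\<forall>i<n. \<bar>blinfun_apply (fst (f i)) x - L (fst (f i))\<bar> < d / 10))"
    for f :: "nat \<Rightarrow> ('a \<Rightarrow>\<^sub>L real) \<times> 'a \<times> 'a" and n
  have "\<exists>f. \<forall>n. Q f n (f n)"
  proof (rule dependent_wellorder_choice)
    fix q and f g :: "nat \<Rightarrow> ('a \<Rightarrow>\<^sub>L real) \<times> 'a \<times> 'a" and n :: nat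
    assume "\<And>y. y < n \<Longrightarrow> f y = g y"
    then show "Q f n q = Q g n q" by (auto simp: Q_def)
  next
    fix n and f :: "nat \<Rightarrow> ('a \<Rightarrow>\<^sub>L real) \<times> 'a \<times> 'a"
    obtain F where F: "norm F = 1" "d < L F" "\<forall>x\<in>(\<lambda>i. snd (snd (f i))) ` {..<n}. blinfun_apply F x = 0"
      using ex_F[of "(\<lambda>i. snd (snd (f i))) ` {..<n}"] by auto
    obtain w x where "w \<in> convex hull K" "norm (x - r *\<^sub>R w) \<le> d / 10"
      "\<forall>G\<in>insert F ((\<lambda>i. fst (f i)) ` {..<n}). \<bar>blinfun_apply G x - L G\<bar> < d / 10"
      using approx[of "insert F ((\<lambda>i. fst (f i)) ` {..<n})" "d / 10"] d by auto
    with F show "\<exists>q. Q f n q" by (intro exI[of _ "(F, w, x)"]) (auto simp: Q_def)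
  qed
  then obtain f where f: "\<And>n. Q f n (f n)" by blast
  define F where "F n = fst (f n)" for n
  define w where "w n = fst (snd (f n))" for n
  define x where "x n = snd (snd (f n))" for n
  have props: "norm (F n) = 1" "d < L (F n)" "i < n \<Longrightarrow> F n (x i) = 0"
    "w n \<in> convex hull K" "norm (x n - r *\<^sub>R w n) \<le> d / 10" "i \<le> n \<Longrightarrow> \<bar>F i (x n) - L (F i)\<bar> < d / 10" for n i
    using f[of n] by (auto simp: Q_def F_def w_def x_def split_beta le_less)

  have "\<exists>T. finite T \<and> T \<subseteq> K \<and> w n \<in> convex hull T" for n
    using convex_hull_finite_subset[OF props(4)[of n]] by metis
  then obtain T where T: "\<And>n. finite (T n)" "\<And>n. T n \<subseteq> K" "\<And>n. w n \<in> convex hull (T n)" by metis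
  \<comment> \<open>Only the countably many points of \<open>K\<close> used in the combinations
    \<open>w n\<close> are retained, so that a diagonal subsequence converges at all of
    them.\<close>
  define D where "D = (\<Union>n. T n)"
  have wD: "w n \<in> convex hull D" for n
    using T(3)[of n] hull_mono[of "T n" D] by (auto simp: D_def)
  have DK: "D \<subseteq> K" using T(2) by (auto simp: D_def)
  have "countable D" using T(1) by (auto simp: D_def intro: countable_finite)
  obtain R where R: "\<And>c. c \<in> K \<Longrightarrow> norm c \<le> R" using K(2) unfolding bounded_iff by auto
  have bdF: "\<bar>blinfun_apply G c\<bar> \<le> norm c" if "norm G \<le> 1" for G :: "'a \<Rightarrow>\<^sub>L real" and c
    using norm_blinfun[of G c] mult_right_mono[OF that, of "norm c"] by simp
  have "norm (F n c) \<le> R" if "c \<in> D" for n c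
    using bdF[of "F n" c] R[of c] that DK by (auto simp: props(1))
  then obtain k where k: "strict_mono k" "\<And>c. c \<in> D \<Longrightarrow> \<exists>l. (\<lambda>n. F (k n) c) \<longlonglongrightarrow> l"
    by (rule function_convergent_subsequence[OF \<open>countable D\<close>, of "\<lambda>n. blinfun_apply (F n)" R]) auto
  have k_ge: "n \<le> k n" for n using seq_suble[OF k(1)] .
  obtain H where H: "norm H \<le> 1" "\<And>y l. (\<lambda>n. F (k n) y) \<longlonglongrightarrow> l \<Longrightarrow> blinfun_apply H y = l"
    using limsup_functional[of "\<lambda>n. F (k n)"] props(1) by (metis order_refl)
  define G where "G n = F (k n) - H" for n
  have G_norm: "norm (G n) \<le> 2" for n
    unfolding G_def using norm_triangle_ineq4[of "F (k n)" H] H(1) by (simp add: props(1))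

  \<comment> \<open>The points where \<open>G\<close> tends to \<open>0\<close> form a norm-closed
    subspace, because the norms of \<open>G n\<close> are uniformly bounded. By Mazur's theorem it
    contains the weak closure \<open>K0\<close> of \<open>D\<close>, which is weakly compact and
    therefore fit for Simons' inequality.\<close>
  define Z where "Z = {y. (\<lambda>n. G n y) \<longlonglongrightarrow> 0}"
  have "subspace Z"
    by (auto simp: subspace_def Z_def blinfun.add_right blinfun.scaleR_right
        intro: tendsto_add[of _ 0 _ _ 0, simplified] tendsto_mult_right_zero)
  have DZ: "D \<subseteq> Z"
  proof
    fix c assume "c \<in> D"
    then obtain l where "(\<lambda>n. F (k n) c) \<longlonglongrightarrow> l" using k(2) by blast
    moreover from this have "H c = l" by (rule H(2))
    ultimately show "c \<in> Z" by (simp add: Z_def G_def blinfun.diff_left LIM_zero)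
  qed
  have closureZ: "closure Z \<subseteq> Z"
  proof
    fix y assume y: "y \<in> closure Z"
    have "\<exists>N. \<forall>n\<ge>N. norm (G n y) < e" if e: "0 < e" for e
    proof -
      obtain z where z: "z \<in> Z" "dist z y < e / 4" using y e unfolding closure_approachable by (metis divide_pos_pos zero_less_numeral)
      then obtain N where N: "\<And>n. n \<ge> N \<Longrightarrow> \<bar>G n z\<bar> < e / 2"
        using LIMSEQ_D[of "\<lambda>n. G n z" 0 "e / 2"] e by (auto simp: Z_def)
      have "\<bar>G n y\<bar> < e" if "n \<ge> N" for n
      proof -
        have "\<bar>G n (y - z)\<bar> \<le> norm (G n) * norm (y - z)" using norm_blinfun[of "G n" "y - z"] by simp
        also have "\<dots> \<le> 2 * norm (y - z)" using G_norm by (intro mult_right_mono) auto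
        finally have "\<bar>G n (y - z)\<bar> < e / 2" using z(2) by (simp add: dist_norm norm_minus_commute)
        then show ?thesis using N[OF that] unfolding blinfun.diff_right by linarith
      qed
      then show ?thesis by auto
    qed
    then show "y \<in> Z" by (auto simp: Z_def intro: LIMSEQ_I)
  qed
  define K0 where "K0 = weak_topology closure_of D"
  have DK0: "D \<subseteq> K0" by (auto simp: K0_def intro!: closure_of_subset[THEN subsetD])
  have "closedin weak_topology K" by (rule compactin_imp_closedin[OF Hausdorff_weak_topology K(1)])
  then have K0K: "K0 \<subseteq> K" unfolding K0_def by (rule closure_of_minimal[OF DK])
  have "compactin weak_topology K0"
    unfolding K0_def by (rule closed_compactin[OF K(1)]) (use K0K in \<open>auto simp: K0_def\<close>)
  have K0Z: "K0 \<subseteq> Z"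
  proof
    fix y assume y: "y \<in> K0"
    have "y \<in> closure Z"
    proof (rule mazur[OF subspace_imp_convex[OF \<open>subspace Z\<close>]])
      fix J :: "'a \<Rightarrow>\<^sub>L real" and e :: real assume "0 < e"
      then show "\<exists>c\<in>Z. J c < J y + e"
        using weak_closure_approx[OF y[unfolded K0_def] blinfun.bounded_linear_right, of e J] DZ by blast
    qed
    with closureZ show "y \<in> Z" by auto
  qed

  have Hx: "H (x n) = 0" for n
  proof (rule H(2), rule tendsto_eventually)
    have "F (k j) (x n) = 0" if "Suc n \<le> j" for j
      using that k_ge[of j] by (intro props(3)) simp
    then show "\<forall>\<^sub>F j in sequentially. F (k j) (x n) = 0" by (auto simp: eventually_sequentially)
  qed
  \<comment> \<open>\<open>F (k j) (x n)\<close> exceeds \<open>9 * d / 10\<close>, and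
    \<open>H (x n)\<close> is \<open>0\<close>. Replacing \<open>x n\<close> by
    \<open>r *\<^sub>R w n\<close> costs \<open>d / 10\<close> in each of \<open>F (k j)\<close> and
    \<open>H\<close>.\<close>
  have G_w: "7 * d / (10 * r) \<le> G j (w n)" if "k j \<le> n" for j n
  proof -
    define b where "b = x n - r *\<^sub>R w n"
    have "\<bar>F (k j) b\<bar> \<le> d / 10"
      unfolding b_def by (rule order_trans[OF bdF props(5)]) (simp add: props(1))
    moreover have "\<bar>H b\<bar> \<le> d / 10"
      unfolding b_def by (rule order_trans[OF bdF[OF H(1)] props(5)])
    moreover have "F (k j) (x n) - H (x n) > 9 * d / 10"
      using props(6)[OF that] props(2)[of "k j"] Hx[of n] by linarith
    moreover have "r * G j (w n) = F (k j) (x n) - H (x n) - F (k j) b + H b"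
      by (simp add: G_def b_def blinfun.diff_left blinfun.diff_right blinfun.scaleR_right algebra_simps)
    ultimately have "7 * d / 10 \<le> r * G j (w n)" by linarith
    then show ?thesis using r by (simp add: field_simps)
  qed
  have "bounded K0" using bounded_subset[OF K(2) K0K] .
  moreover have "\<exists>b\<in>K0. \<forall>c\<in>K0. g c \<le> g b" for g :: "'a \<Rightarrow>\<^sub>L real"
  proof -
    have "compactin euclideanreal (blinfun_apply g ` K0)"
      by (rule image_compactin[OF \<open>compactin weak_topology K0\<close>])
         (rule continuous_map_bounded_linear_weak[OF blinfun.bounded_linear_right])
    moreover have "D \<noteq> {}" using wD[of 0] by (auto intro!: Nat.gr0I)
    ultimately show ?thesis using compact_attains_sup[of "blinfun_apply g ` K0"] DK0 by auto
  qed
  \<comment> \<open>A convex combination involves finitely many \<open>G j\<close>, and a single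
    late \<open>w n\<close> serves them all. Since \<open>w n\<close> lies in the hull of
    \<open>D\<close>, some point of \<open>D\<close> does at least as well.\<close>
  moreover have "\<exists>b\<in>K0. 7 * d / (10 * r) \<le> g b" if g: "g \<in> convex hull (range G)" for g
  proof -
    obtain A where A: "finite A" "A \<subseteq> range G" "g \<in> convex hull A" by (rule convex_hull_finite_subset[OF g])
    then obtain J where J: "finite J" "A = G ` J" by (meson finite_subset_image)
    define n where "n = Max (insert 0 (k ` J))"
    have "A \<subseteq> {h. 7 * d / (10 * r) \<le> blinfun_apply h (w n)}" using J by (auto simp: n_def intro!: G_w)
    moreover have "convex ((\<lambda>h. blinfun_apply h (w n)) -` {7 * d / (10 * r)..})"
      by (intro convex_linear_vimage bounded_linear.linear blinfun.bounded_linear_left) simp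
    then have "convex {h. 7 * d / (10 * r) \<le> blinfun_apply h (w n)}" by (simp add: vimage_def)
    ultimately have "convex hull A \<subseteq> {h. 7 * d / (10 * r) \<le> blinfun_apply h (w n)}" by (rule hull_minimal)
    with A(3) have "7 * d / (10 * r) \<le> g (w n)" by auto
    then show ?thesis using convex_hull_blinfun_less[OF wD] DK0 by blast
  qed
  ultimately obtain b where b: "b \<in> K0" "\<And>n. \<exists>m\<ge>n. 7 * d / (10 * r) / 4 \<le> G m b"
    using simons[of K0 G 2 "7 * d / (10 * r)"] G_norm d r by (metis divide_pos_pos mult_pos_pos zero_less_numeral)
  have "(\<lambda>n. G n b) \<longlonglongrightarrow> 0" using b(1) K0Z by (auto simp: Z_def)
  moreover have "0 < 7 * d / (10 * r) / 4" using d r by simp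
  ultimately obtain N where "\<And>n. n \<ge> N \<Longrightarrow> G n b < 7 * d / (10 * r) / 4"
    using order_tendstoD(2) by (fastforce simp: eventually_sequentially)
  with b(2)[of N] show False by fastforce
qed

text \<open>Evaluations at \<open>z n\<close> approximate \<open>L\<close> to within
  \<open>1 / (n + 1)\<close> in the dual norm, the one-sided bound being symmetrised by
  \<open>F \<mapsto> - F\<close>. Norming functionals turn this into a Cauchy estimate for
  \<open>z\<close> itself.\<close>

lemma krein:
  fixes L :: "('a::real_normed_vector \<Rightarrow>\<^sub>L real) \<Rightarrow> real"
  assumes complete: "complete (UNIV :: 'a set)"
    and L: "linear L" and K: "compactin weak_topology K" "bounded K"
    and approx: "\<And>e. 0 < e \<Longrightarrow> \<exists>r>0. \<forall>\<F> \<eta>. finite \<F> \<longrightarrow> 0 < \<eta> \<longrightarrow>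
      (\<exists>w\<in>convex hull K. \<exists>x. norm (x - r *\<^sub>R w) \<le> e \<and> (\<forall>F\<in>\<F>. \<bar>blinfun_apply F x - L F\<bar> < \<eta>))"
  obtains x where "\<And>F. L F = blinfun_apply F x"
proof -
  have "\<exists>z. \<forall>F. L F - blinfun_apply F z \<le> d * norm F" if d: "0 < d" for d
  proof -
    obtain r where "0 < r" "\<And>\<F> \<eta>. finite \<F> \<Longrightarrow> 0 < \<eta> \<Longrightarrow>
      \<exists>w\<in>convex hull K. \<exists>x. norm (x - r *\<^sub>R w) \<le> d / 10 \<and> (\<forall>F\<in>\<F>. \<bar>blinfun_apply F x - L F\<bar> < \<eta>)"
      using approx[of "d / 10"] d by auto
    then show ?thesis by (intro krein_approx[OF L d K])
  qed
  then have "\<exists>z. \<forall>F. L F - blinfun_apply F z \<le> 1 / real (Suc n) * norm F" for n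
    by (metis of_nat_0_less_iff zero_less_Suc zero_less_divide_1_iff)
  then obtain z where z: "\<And>n F. L F - blinfun_apply F (z n) \<le> 1 / real (Suc n) * norm F" by metis
  have z': "\<bar>L F - blinfun_apply F (z n)\<bar> \<le> 1 / real (Suc n) * norm F" for n F
    using z[of F n] z[of "- F" n] by (simp add: abs_le_iff blinfun.minus_left linear_neg[OF L])
  have "norm (z m - z n) \<le> 1 / real (Suc m) + 1 / real (Suc n)" for m n
  proof -
    obtain F :: "'a \<Rightarrow>\<^sub>L real" where F: "norm F \<le> 1" "norm (z m - z n) \<le> F (z m - z n)" by (rule norming_functional)
    have "F (z m - z n) \<le> 1 / real (Suc m) * norm F + 1 / real (Suc n) * norm F"
      using z'[of F m] z'[of F n] by (simp add: blinfun.diff_right)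
    also have "\<dots> \<le> 1 / real (Suc m) * 1 + 1 / real (Suc n) * 1"
      using F(1) by (intro add_mono mult_left_mono) auto
    finally show ?thesis using F(2) by simp
  qed
  then have dist: "dist (z m) (z n) \<le> 1 / real (Suc m) + 1 / real (Suc n)" for m n by (simp add: dist_norm)
  have "Cauchy z"
  proof (rule metric_CauchyI)
    fix e :: real assume "0 < e"
    then obtain N where N: "1 / real (Suc N) < e / 2" using nat_approx_posE[of "e / 2"] by (auto simp: inverse_eq_divide)
    have "dist (z m) (z n) < e" if "m \<ge> N" "n \<ge> N" for m n
    proof -
      have "1 / real (Suc m) \<le> 1 / real (Suc N)" "1 / real (Suc n) \<le> 1 / real (Suc N)"
        using that by (auto intro!: divide_left_mono)
      then show ?thesis using dist[of m n] N by linarith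
    qed
    then show "\<exists>M. \<forall>m\<ge>M. \<forall>n\<ge>M. dist (z m) (z n) < e" by blast
  qed
  then obtain x where x: "z \<longlonglongrightarrow> x" using completeE[OF complete, of z] by auto
  have "L F = F x" for F
  proof -
    have "(\<lambda>n. L F - F (z n)) \<longlonglongrightarrow> 0"
    proof (rule Lim_null_comparison)
      show "\<forall>\<^sub>F n in sequentially. norm (L F - F (z n)) \<le> 1 / real (Suc n) * norm F"
        using z'[of F] by simp
      show "(\<lambda>n. 1 / real (Suc n) * norm F) \<longlonglongrightarrow> 0"
        by (intro tendsto_mult_left_zero LIMSEQ_Suc[OF lim_1_over_n])
    qed
    moreover have "(\<lambda>n. L F - F (z n)) \<longlonglongrightarrow> L F - F x" by (intro tendsto_intros blinfun.tendsto x)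
    ultimately show ?thesis using LIMSEQ_unique by fastforce
  qed
  then show ?thesis by (rule that)
qed

section \<open>Reflexive spaces and their representations\<close>

lemma dual_spaceD:
  assumes "\<phi> \<in> dual_space V N"
  shows "x \<in> V \<Longrightarrow> y \<in> V \<Longrightarrow> \<phi> (x + y) = \<phi> x + \<phi> y"
    and "x \<in> V \<Longrightarrow> \<phi> (c *\<^sub>R x) = c * \<phi> x"
    and "x \<notin> V \<Longrightarrow> \<phi> x = 0"
    and "\<exists>B. \<forall>x\<in>V. \<bar>\<phi> x\<bar> \<le> B * N x"
  using assms by (auto simp: dual_space_def linear_map_on_def)

lemma dual_spaceI:
  assumes "\<And>x y. x \<in> V \<Longrightarrow> y \<in> V \<Longrightarrow> \<phi> (x + y) = \<phi> x + \<phi> y"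
    and "\<And>c x. x \<in> V \<Longrightarrow> \<phi> (c *\<^sub>R x) = c * \<phi> x"
    and "\<And>x. x \<notin> V \<Longrightarrow> \<phi> x = 0"
    and "\<And>x. x \<in> V \<Longrightarrow> \<bar>\<phi> x\<bar> \<le> B * N x"
  shows "\<phi> \<in> dual_space V N"
  unfolding dual_space_def linear_map_on_def by (auto simp: assms intro!: exI[of _ B])

context banach_space_on
begin

abbreviation "D \<equiv> dual_space V N"

lemma zero_in [simp]: "0 \<in> V" and add_in: "x \<in> V \<Longrightarrow> y \<in> V \<Longrightarrow> x + y \<in> V"
  and scale_in: "x \<in> V \<Longrightarrow> c *\<^sub>R x \<in> V" and diff_in: "x \<in> V \<Longrightarrow> y \<in> V \<Longrightarrow> x - y \<in> V"
  using subspace by (auto simp: subspace_0 subspace_add subspace_scale subspace_diff)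

lemma norm_0 [simp]: "N 0 = 0"
  using norm_eq_0[of 0] by simp

lemma dual_0: "\<phi> \<in> D \<Longrightarrow> \<phi> 0 = 0"
  using dual_spaceD(2)[of \<phi> V N 0 0] by simp

lemma dual_diff: "\<phi> \<in> D \<Longrightarrow> x \<in> V \<Longrightarrow> y \<in> V \<Longrightarrow> \<phi> (x - y) = \<phi> x - \<phi> y"
  using dual_spaceD(1)[of \<phi> V N "x - y" y] by (simp add: diff_in)

lemma norm_diff_le: "x \<in> V \<Longrightarrow> y \<in> V \<Longrightarrow> N (x - y) \<le> N x + N y"
  using norm_triangle[of x "(-1) *\<^sub>R y"] norm_scaleR[of y "-1"] scale_in[of y "-1"] by simp

lemma zero_dual: "(\<lambda>_. 0) \<in> D"
  by (rule dual_spaceI[where B = 0]) auto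

lemma add_dual:
  assumes "\<phi> \<in> D" "\<psi> \<in> D"
  shows "(\<lambda>x. \<phi> x + \<psi> x) \<in> D"
proof -
  obtain B C where "\<And>x. x \<in> V \<Longrightarrow> \<bar>\<phi> x\<bar> \<le> B * N x" "\<And>x. x \<in> V \<Longrightarrow> \<bar>\<psi> x\<bar> \<le> C * N x"
    using dual_spaceD(4)[OF assms(1)] dual_spaceD(4)[OF assms(2)] by blast
  then have "\<bar>\<phi> x + \<psi> x\<bar> \<le> (B + C) * N x" if "x \<in> V" for x
    using that by (simp add: distrib_right) (meson abs_triangle_ineq add_mono order_trans)
  then show ?thesis
    by (intro dual_spaceI[where B = "B + C"])
       (simp_all add: dual_spaceD[OF assms(1)] dual_spaceD[OF assms(2)] algebra_simps)
qed

lemma scale_dual: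
  assumes "\<phi> \<in> D"
  shows "(\<lambda>x. c * \<phi> x) \<in> D"
proof -
  obtain B where "\<And>x. x \<in> V \<Longrightarrow> \<bar>\<phi> x\<bar> \<le> B * N x"
    using dual_spaceD(4)[OF assms] by blast
  then have "\<bar>c * \<phi> x\<bar> \<le> (\<bar>c\<bar> * B) * N x" if "x \<in> V" for x
    using that by (simp add: abs_mult mult.assoc mult_left_mono)
  then show ?thesis
    by (intro dual_spaceI[where B = "\<bar>c\<bar> * B"]) (simp_all add: dual_spaceD[OF assms] algebra_simps)
qed

lemma dual_bdd:
  assumes "\<phi> \<in> D"
  shows "bdd_above ((\<lambda>x. \<bar>\<phi> x\<bar>) ` {x \<in> V. N x \<le> 1})"
proof -
  obtain B where B: "\<And>x. x \<in> V \<Longrightarrow> \<bar>\<phi> x\<bar> \<le> B * N x"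
    using dual_spaceD(4)[OF assms] by blast
  show ?thesis
  proof (rule bdd_aboveI2[of _ _ "\<bar>B\<bar>"])
    fix x assume x: "x \<in> {x \<in> V. N x \<le> 1}"
    then have "B * N x \<le> \<bar>B\<bar> * 1" using norm_nonneg by (intro mult_mono) auto
    then show "\<bar>\<phi> x\<bar> \<le> \<bar>B\<bar>" using B[of x] x by simp
  qed
qed

lemma dual_norm_upper: "\<phi> \<in> D \<Longrightarrow> x \<in> V \<Longrightarrow> N x \<le> 1 \<Longrightarrow> \<bar>\<phi> x\<bar> \<le> dual_norm V N \<phi>"
  unfolding dual_norm_def by (rule cSUP_upper[OF _ dual_bdd]) auto

lemma dual_norm_least: "(\<And>x. x \<in> V \<Longrightarrow> N x \<le> 1 \<Longrightarrow> \<bar>\<phi> x\<bar> \<le> c) \<Longrightarrow> dual_norm V N \<phi> \<le> c"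
  unfolding dual_norm_def by (rule cSUP_least) (auto intro: exI[of _ 0])

lemma dual_norm_nonneg: "\<phi> \<in> D \<Longrightarrow> 0 \<le> dual_norm V N \<phi>"
  using dual_norm_upper[of \<phi> 0] by simp

lemma dual_norm_bound:
  assumes "\<phi> \<in> D" "x \<in> V"
  shows "\<bar>\<phi> x\<bar> \<le> dual_norm V N \<phi> * N x"
proof (cases "N x = 0")
  case True
  then show ?thesis using norm_eq_0[OF assms(2)] dual_0[OF assms(1)] by simp
next
  case False
  then have n: "0 < N x" using norm_nonneg[OF assms(2)] by simp
  have "\<bar>\<phi> ((1 / N x) *\<^sub>R x)\<bar> \<le> dual_norm V N \<phi>"
    by (rule dual_norm_upper[OF assms(1) scale_in[OF assms(2)]]) (use n assms in \<open>simp add: norm_scaleR\<close>)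
  then show ?thesis using n assms by (simp add: dual_spaceD(2)[OF assms] abs_mult field_simps)
qed

text \<open>Goldstine's theorem by least squares: at a near-minimiser \<open>x\<close> of \<open>\<Sum>\<phi>. (\<Lambda> \<phi> - \<phi> x)\<^sup>2\<close> over a ball,
  the functional \<open>\<psi> = \<Sum>\<phi>. (\<Lambda> \<phi> - \<phi> x) \<phi>\<close> almost attains its norm, so that
  \<open>\<Lambda> \<psi> - \<psi> x\<close>, which is the value of the minimised sum, is small.\<close>

lemma goldstine:
  assumes add: "\<And>\<phi> \<psi>. \<phi> \<in> D \<Longrightarrow> \<psi> \<in> D \<Longrightarrow> \<Lambda> (\<lambda>x. \<phi> x + \<psi> x) = \<Lambda> \<phi> + \<Lambda> \<psi>"
    and scale: "\<And>c \<phi>. \<phi> \<in> D \<Longrightarrow> \<Lambda> (\<lambda>x. c * \<phi> x) = c * \<Lambda> \<phi>"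
    and bound: "\<And>\<phi>. \<phi> \<in> D \<Longrightarrow> \<bar>\<Lambda> \<phi>\<bar> \<le> B * dual_norm V N \<phi>"
    and B: "0 < B" and \<Phi>: "finite \<Phi>" "\<Phi> \<subseteq> D" and \<eta>: "0 < \<eta>"
  obtains x where "x \<in> V" "N x \<le> B" "\<And>\<phi>. \<phi> \<in> \<Phi> \<Longrightarrow> \<bar>\<phi> x - \<Lambda> \<phi>\<bar> < \<eta>"
proof -
  define Ball where "Ball = {x \<in> V. N x \<le> B}"
  define E where "E x = (\<Sum>\<phi>\<in>\<Phi>. (\<Lambda> \<phi> - \<phi> x)\<^sup>2)" for x
  have sum_dual: "(\<lambda>x. \<Sum>\<phi>\<in>\<Psi>. a \<phi> * \<phi> x) \<in> D \<and> \<Lambda> (\<lambda>x. \<Sum>\<phi>\<in>\<Psi>. a \<phi> * \<phi> x) = (\<Sum>\<phi>\<in>\<Psi>. a \<phi> * \<Lambda> \<phi>)"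
    if "finite \<Psi>" "\<Psi> \<subseteq> D" for a \<Psi>
    using that
  proof (induction \<Psi>)
    case empty
    show ?case using zero_dual scale[OF zero_dual, of 0] by simp
  next
    case (insert \<phi> \<Psi>)
    then show ?case
      using add_dual[OF scale_dual[of \<phi> "a \<phi>"], of "\<lambda>x. \<Sum>\<phi>\<in>\<Psi>. a \<phi> * \<phi> x"]
        add[OF scale_dual[of \<phi> "a \<phi>"], of "\<lambda>x. \<Sum>\<phi>\<in>\<Psi>. a \<phi> * \<phi> x"] by (simp add: scale)
  qed
  have "\<exists>x\<in>Ball. E x < \<eta>\<^sup>2"
  proof (rule ccontr)
    assume "\<not> (\<exists>x\<in>Ball. E x < \<eta>\<^sup>2)"
    then have far: "\<eta>\<^sup>2 \<le> E x" if "x \<in> Ball" for x using that by (auto simp: not_less)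
    have ne: "Ball \<noteq> {}" using B by (auto simp: Ball_def intro: exI[of _ 0])
    have bdd: "bdd_below (E ` Ball)" by (rule bdd_belowI2[of _ "\<eta>\<^sup>2"]) (rule far)
    define C where "C = (\<Sum>\<phi>\<in>\<Phi>. (dual_norm V N \<phi> * (2 * B))\<^sup>2)"
    have C: "0 \<le> C" unfolding C_def by (intro sum_nonneg) auto
    have diff_bound: "(\<Sum>\<phi>\<in>\<Phi>. (\<phi> (y - x))\<^sup>2) \<le> C" if "x \<in> Ball" "y \<in> Ball" for x y
      unfolding C_def
    proof (rule sum_mono)
      fix \<phi> assume \<phi>: "\<phi> \<in> \<Phi>"
      have "N (y - x) \<le> 2 * B" "y - x \<in> V"
        using that norm_diff_le[of y x] by (auto simp: Ball_def diff_in)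
      then have "\<bar>\<phi> (y - x)\<bar> \<le> dual_norm V N \<phi> * (2 * B)"
        using \<phi> \<Phi>(2) dual_norm_bound[of \<phi> "y - x"] dual_norm_nonneg[of \<phi>]
        by (meson mult_left_mono order_trans subsetD)
      then show "(\<phi> (y - x))\<^sup>2 \<le> (dual_norm V N \<phi> * (2 * B))\<^sup>2"
        using power_mono[of "\<bar>\<phi> (y - x)\<bar>" _ 2] by simp
    qed
    \<comment> \<open>Step width along segments from \<open>x\<close>. It keeps the quadratic term
      \<open>t\<^sup>2 * C\<close> below \<open>t * \<eta>\<^sup>2 / 2\<close>; together with
      \<open>\<tau> = t * \<eta>\<^sup>2 / 4\<close> and after division by \<open>2 * t\<close> this
      leaves the \<open>3 / 8\<close> below.\<close>
    define t where "t = min 1 (\<eta>\<^sup>2 / (2 * (C + 1)))"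
    have t: "0 < t" "t \<le> 1" "t * C \<le> \<eta>\<^sup>2 / 2"
    proof -
      show "0 < t" "t \<le> 1" using \<eta> C by (auto simp: t_def)
      have "t * C \<le> \<eta>\<^sup>2 / (2 * (C + 1)) * (C + 1)" using C by (intro mult_mono) (auto simp: t_def)
      also have "\<dots> = \<eta>\<^sup>2 / 2" using C by (simp add: field_simps)
      finally show "t * C \<le> \<eta>\<^sup>2 / 2" .
    qed
    define \<tau> where "\<tau> = t * \<eta>\<^sup>2 / 4"
    have "0 < \<tau>" using t \<eta> by (simp add: \<tau>_def)
    then obtain x where x: "x \<in> Ball" "E x < (INF x\<in>Ball. E x) + \<tau>"
      using cINF_less_iff[OF ne bdd, of "(INF x\<in>Ball. E x) + \<tau>"] by auto
    have min: "E x - \<tau> \<le> E y" if "y \<in> Ball" for y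
      using cINF_lower[OF bdd that] x(2) by linarith
    have xV: "x \<in> V" using x(1) by (simp add: Ball_def)
    define a where "a \<phi> = \<Lambda> \<phi> - \<phi> x" for \<phi>
    define \<psi> where "\<psi> = (\<lambda>y. \<Sum>\<phi>\<in>\<Phi>. a \<phi> * \<phi> y)"
    have \<psi>: "\<psi> \<in> D" "\<Lambda> \<psi> = (\<Sum>\<phi>\<in>\<Phi>. a \<phi> * \<Lambda> \<phi>)" unfolding \<psi>_def using sum_dual[OF \<Phi>] by auto
    \<comment> \<open>First-order optimality: \<open>-2 * \<psi> (y - x)\<close> is the derivative
      of \<open>E\<close> from \<open>x\<close> towards \<open>y\<close>, and \<open>E\<close> can
      drop by at most \<open>\<tau>\<close>.\<close>
    have small: "\<psi> y \<le> \<psi> x + \<eta>\<^sup>2 * 3 / 8" if y: "y \<in> Ball" for y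
    proof -
      have yV: "y \<in> V" using y by (simp add: Ball_def)
      define z where "z = x + t *\<^sub>R (y - x)"
      have "z = (1 - t) *\<^sub>R x + t *\<^sub>R y" by (simp add: z_def algebra_simps)
      then have "N z \<le> (1 - t) * N x + t * N y"
        using norm_triangle[OF scale_in[OF xV, of "1 - t"] scale_in[OF yV, of t]] t xV yV
        by (simp add: norm_scaleR)
      also have "\<dots> \<le> (1 - t) * B + t * B"
        using x(1) y t by (intro add_mono mult_left_mono) (auto simp: Ball_def)
      finally have "z \<in> Ball"
        using xV yV by (simp add: Ball_def z_def add_in scale_in diff_in algebra_simps)
      then have "E x - \<tau> \<le> E z" by (rule min)
      also have "E z = (\<Sum>\<phi>\<in>\<Phi>. (a \<phi>)\<^sup>2 - 2 * t * (a \<phi> * \<phi> (y - x)) + t\<^sup>2 * (\<phi> (y - x))\<^sup>2)"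
        unfolding E_def
      proof (rule sum.cong[OF refl])
        fix \<phi> assume "\<phi> \<in> \<Phi>"
        then have "\<phi> \<in> D" using \<Phi>(2) by auto
        then have "\<phi> z = \<phi> x + t * \<phi> (y - x)"
          using xV yV by (simp add: z_def dual_spaceD(1,2) scale_in diff_in)
        then show "(\<Lambda> \<phi> - \<phi> z)\<^sup>2 = (a \<phi>)\<^sup>2 - 2 * t * (a \<phi> * \<phi> (y - x)) + t\<^sup>2 * (\<phi> (y - x))\<^sup>2"
          by (simp add: a_def power2_eq_square algebra_simps)
      qed
      also have "\<dots> = E x - 2 * t * \<psi> (y - x) + t\<^sup>2 * (\<Sum>\<phi>\<in>\<Phi>. (\<phi> (y - x))\<^sup>2)"
        by (simp add: sum.distrib sum_subtractf sum_distrib_left E_def \<psi>_def a_def mult.assoc)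
      also have "\<dots> \<le> E x - 2 * t * \<psi> (y - x) + t\<^sup>2 * C"
        using diff_bound[OF x(1) y] by (simp add: mult_left_mono)
      finally have "2 * t * \<psi> (y - x) \<le> \<tau> + t\<^sup>2 * C" by simp
      also have "\<dots> \<le> 2 * t * (\<eta>\<^sup>2 * 3 / 8)"
        using mult_left_mono[OF t(3), of t] t(1) by (simp add: \<tau>_def power2_eq_square mult_ac)
      finally have "\<psi> (y - x) \<le> \<eta>\<^sup>2 * 3 / 8" using t(1) by simp
      then show ?thesis using dual_diff[OF \<psi>(1) yV xV] by simp
    qed
    \<comment> \<open>The ball is symmetric, so the bound on \<open>\<psi>\<close> at
      \<open>B *\<^sub>R y\<close> and at its negative controls
      \<open>B * \<bar>\<psi> y\<bar>\<close>.\<close>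
    have "dual_norm V N \<psi> \<le> (\<psi> x + \<eta>\<^sup>2 * 3 / 8) / B"
    proof (rule dual_norm_least)
      fix y assume y: "y \<in> V" "N y \<le> 1"
      have "B *\<^sub>R y \<in> Ball" "(- B) *\<^sub>R y \<in> Ball"
        using y B scale_in[OF y(1), of B] scale_in[OF y(1), of "- B"] by (auto simp: Ball_def norm_scaleR[OF y(1)] norm_scaleR[OF y(1), of "- B", simplified])
      from small[OF this(1)] small[OF this(2)] have "B * \<bar>\<psi> y\<bar> \<le> \<psi> x + \<eta>\<^sup>2 * 3 / 8"
        unfolding dual_spaceD(2)[OF \<psi>(1) y(1)] by (cases "0 \<le> \<psi> y") auto
      then show "\<bar>\<psi> y\<bar> \<le> (\<psi> x + \<eta>\<^sup>2 * 3 / 8) / B" using B by (simp add: field_simps)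
    qed
    then have "\<Lambda> \<psi> \<le> \<psi> x + \<eta>\<^sup>2 * 3 / 8" using bound[OF \<psi>(1)] B by (simp add: field_simps)
    moreover have "\<Lambda> \<psi> - \<psi> x = E x"
      unfolding \<psi>(2) by (simp add: \<psi>_def E_def a_def sum_subtractf[symmetric] power2_eq_square algebra_simps)
    ultimately have "\<eta>\<^sup>2 \<le> \<eta>\<^sup>2 * 3 / 8" using far[OF x(1)] by linarith
    then show False using \<eta> by simp
  qed
  then obtain x where x: "x \<in> Ball" "E x < \<eta>\<^sup>2" by auto
  have "\<bar>\<phi> x - \<Lambda> \<phi>\<bar> < \<eta>" if "\<phi> \<in> \<Phi>" for \<phi>
  proof -
    have "(\<Lambda> \<phi> - \<phi> x)\<^sup>2 \<le> E x" unfolding E_def by (rule member_le_sum[OF that]) (use \<Phi> in auto)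
    then have "\<bar>\<phi> x - \<Lambda> \<phi>\<bar>\<^sup>2 < \<eta>\<^sup>2" using x(2) by (simp add: power2_commute)
    then show ?thesis using \<eta> by (rule power_less_imp_less_base[OF _ less_imp_le])
  qed
  then show ?thesis using x(1) by (intro that[of x]) (auto simp: Ball_def)
qed

section \<open>Weak compactness of balls in reflexive spaces\<close>

definition weak_embedding :: "'v \<Rightarrow> ('v \<Rightarrow> real) \<Rightarrow> real" where
  "weak_embedding v = restrict (\<lambda>\<phi>. \<phi> v) D"

text \<open>Bounding \<open>v\<close> through the dual norm instead of \<open>N v \<le> r\<close> makes the set closed under weak limits without an
  appeal to norming functionals on \<open>V\<close>.\<close>

definition weak_ball :: "real \<Rightarrow> 'v set" where
  "weak_ball r = {v \<in> V. \<forall>\<phi>\<in>D. \<bar>\<phi> v\<bar> \<le> r * dual_norm V N \<phi>}"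

lemma weak_ballI: "v \<in> V \<Longrightarrow> N v \<le> r \<Longrightarrow> v \<in> weak_ball r"
  unfolding weak_ball_def
proof clarify
  fix \<phi> assume v: "v \<in> V" "N v \<le> r" and \<phi>: "\<phi> \<in> D"
  show "\<bar>\<phi> v\<bar> \<le> r * dual_norm V N \<phi>"
    using dual_norm_bound[OF \<phi> v(1)] mult_left_mono[OF v(2) dual_norm_nonneg[OF \<phi>]]
    by (simp add: mult.commute)
qed

text \<open>The Banach-Alaoglu argument on the bidual: in a product of compact intervals the
  additive and homogeneous elements form a closed set, and reflexivity identifies them with
  evaluations at points of \<open>V\<close>.\<close>

lemma compactin_weak_ball:
  assumes "reflexive_on V N"
  shows "compactin (product_topology (\<lambda>_. euclideanreal) D) (weak_embedding ` weak_ball r)"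
proof -
  let ?X = "product_topology (\<lambda>_ :: 'v \<Rightarrow> real. euclideanreal) D"
  define P where "P = (\<Pi>\<^sub>E \<phi>\<in>D. {- (r * dual_norm V N \<phi>)..r * dual_norm V N \<phi>})"
  have P: "compactin ?X P" unfolding P_def by (simp add: compactin_PiE)
  have proj: "continuous_map ?X euclideanreal (\<lambda>\<Lambda>. \<Lambda> \<phi>)" if "\<phi> \<in> D" for \<phi>
    using continuous_map_product_projection[OF that, of "\<lambda>_. euclideanreal"] by simp
  define A where "A = (\<lambda>(\<phi>, \<psi>). {\<Lambda> \<in> topspace ?X. \<Lambda> (\<lambda>x. \<phi> x + \<psi> x) = \<Lambda> \<phi> + \<Lambda> \<psi>}) ` (D \<times> D)"
  define H where "H = (\<lambda>(c, \<phi>). {\<Lambda> \<in> topspace ?X. \<Lambda> (\<lambda>x. c * \<phi> x) = c * \<Lambda> \<phi>}) ` (UNIV \<times> D)"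
  have "closedin ?X Z" if "Z \<in> A \<union> H" for Z
    using that unfolding A_def H_def Un_iff
    by (elim disjE imageE SigmaE)
       (simp_all only: split, (intro closedin_continuous_maps_eq[of euclideanreal] Hausdorff_space_euclidean
        continuous_map_add continuous_map_real_mult_left proj add_dual scale_dual; assumption)+)
  then have "compactin ?X (\<Inter> (insert P (A \<union> H)))"
    using P compactin_imp_closedin[OF _ P] by (intro closed_compactin_Inter[OF P])
      (auto simp: Hausdorff_space_product_topology)
  moreover have "\<Inter> (insert P (A \<union> H)) = weak_embedding ` weak_ball r"
  proof (intro set_eqI iffI)
    fix \<Lambda> assume \<Lambda>: "\<Lambda> \<in> \<Inter> (insert P (A \<union> H))"
    have add: "\<Lambda> (\<lambda>x. \<phi> x + \<psi> x) = \<Lambda> \<phi> + \<Lambda> \<psi>" if "\<phi> \<in> D" "\<psi> \<in> D" for \<phi> \<psi>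
    proof -
      have "{\<Lambda> \<in> topspace ?X. \<Lambda> (\<lambda>x. \<phi> x + \<psi> x) = \<Lambda> \<phi> + \<Lambda> \<psi>} \<in> A"
        unfolding A_def by (rule image_eqI[of _ _ "(\<phi>, \<psi>)"]) (use that in auto)
      then show ?thesis using \<Lambda> by blast
    qed
    have scale: "\<Lambda> (\<lambda>x. c * \<phi> x) = c * \<Lambda> \<phi>" if "\<phi> \<in> D" for c \<phi>
    proof -
      have "{\<Lambda> \<in> topspace ?X. \<Lambda> (\<lambda>x. c * \<phi> x) = c * \<Lambda> \<phi>} \<in> H"
        unfolding H_def by (rule image_eqI[of _ _ "(c, \<phi>)"]) (use that in auto)
      then show ?thesis using \<Lambda> by blast
    qed
    have bound: "\<bar>\<Lambda> \<phi>\<bar> \<le> r * dual_norm V N \<phi>" if "\<phi> \<in> D" for \<phi>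
    proof -
      have "\<Lambda> \<in> P" using \<Lambda> by blast
      from PiE_mem[OF this[unfolded P_def] that] show ?thesis by (simp add: abs_le_iff minus_le_iff)
    qed
    obtain v where v: "v \<in> V" "\<And>\<phi>. \<phi> \<in> D \<Longrightarrow> \<Lambda> \<phi> = \<phi> v"
      using assms[unfolded reflexive_on_def, rule_format, of \<Lambda>] add scale bound by blast
    have "\<Lambda> = weak_embedding v"
      using \<Lambda> v(2) by (auto simp: weak_embedding_def P_def fun_eq_iff PiE_def extensional_def)
    moreover have "v \<in> weak_ball r" using v bound by (auto simp: weak_ball_def)
    ultimately show "\<Lambda> \<in> weak_embedding ` weak_ball r" by blast
  next
    fix \<Lambda> assume "\<Lambda> \<in> weak_embedding ` weak_ball r"
    then obtain v where v: "\<Lambda> = weak_embedding v" "v \<in> weak_ball r" by auto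
    then show "\<Lambda> \<in> \<Inter> (insert P (A \<union> H))"
      by (auto simp: P_def A_def H_def weak_embedding_def weak_ball_def add_dual scale_dual abs_le_iff minus_le_iff)
  qed
  ultimately show ?thesis by simp
qed

text \<open>A functional on the target composed with \<open>T\<close> belongs to \<open>D\<close>
  and is therefore a coordinate of the product. Hence \<open>T\<close> descends to a continuous map
  \<open>g\<close> on the embedded ball, well defined because functionals separate the points of the
  target.\<close>

lemma compactin_weak_ball_image:
  fixes T :: "'v \<Rightarrow> 'b::real_normed_vector"
  assumes refl: "reflexive_on V N"
    and T: "\<And>x y. x \<in> V \<Longrightarrow> y \<in> V \<Longrightarrow> T (x + y) = T x + T y"
      "\<And>c x. x \<in> V \<Longrightarrow> T (c *\<^sub>R x) = c *\<^sub>R T x"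
      "\<And>x. x \<in> V \<Longrightarrow> norm (T x) \<le> B * N x"
  shows "compactin weak_topology (T ` weak_ball r)"
proof -
  let ?X = "product_topology (\<lambda>_ :: 'v \<Rightarrow> real. euclideanreal) D"
  have dual: "(\<lambda>v. if v \<in> V then F (T v) else 0) \<in> D" if F: "bounded_linear F" for F
  proof -
    interpret F: bounded_linear F by fact
    obtain K where K: "0 \<le> K" "\<And>x. norm (F x) \<le> norm x * K" using F.nonneg_bounded by auto
    have "\<bar>F (T v)\<bar> \<le> (B * K) * N v" if "v \<in> V" for v
      using order_trans[OF K(2)[of "T v"] mult_right_mono[OF T(3)[OF that] K(1)]] by (simp add: algebra_simps)
    then show ?thesis
      by (intro dual_spaceI[where B = "B * K"]) (auto simp: add_in scale_in T F.add F.scaleR)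
  qed
  define g where "g \<Lambda> = (THE w. \<forall>v\<in>weak_ball r. weak_embedding v = \<Lambda> \<longrightarrow> T v = w)" for \<Lambda>
  have g: "g (weak_embedding v) = T v" if v: "v \<in> weak_ball r" for v
    unfolding g_def
  proof (rule the_equality)
    show "\<forall>u\<in>weak_ball r. weak_embedding u = weak_embedding v \<longrightarrow> T u = T v"
    proof (intro ballI impI)
      fix u assume u: "u \<in> weak_ball r" and eq: "weak_embedding u = weak_embedding v"
      obtain F :: "'b \<Rightarrow>\<^sub>L real" where F: "norm (T u - T v) \<le> F (T u - T v)" by (rule norming_functional)
      have "F (T u) = F (T v)"
        using fun_cong[OF eq, of "\<lambda>v. if v \<in> V then F (T v) else 0"] dual[OF blinfun.bounded_linear_right, of F] u v
        by (simp add: weak_embedding_def weak_ball_def)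
      then show "T u = T v" using F by (simp add: blinfun.diff_right)
    qed
  qed (use v in auto)
  have "continuous_map (subtopology ?X (weak_embedding ` weak_ball r)) weak_topology g"
  proof (rule continuous_map_weak_topology)
    fix F :: "'b \<Rightarrow> real" assume F: "bounded_linear F"
    let ?\<phi> = "\<lambda>v. if v \<in> V then F (T v) else 0"
    have "continuous_map (subtopology ?X (weak_embedding ` weak_ball r)) euclideanreal (\<lambda>\<Lambda>. \<Lambda> ?\<phi>)"
      using continuous_map_product_projection[OF dual[OF F], of "\<lambda>_. euclideanreal"]
      by (simp add: continuous_map_from_subtopology)
    then show "continuous_map (subtopology ?X (weak_embedding ` weak_ball r)) euclideanreal (\<lambda>\<Lambda>. F (g \<Lambda>))"
    proof (rule continuous_map_eq)
      fix \<Lambda> assume "\<Lambda> \<in> topspace (subtopology ?X (weak_embedding ` weak_ball r))"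
      then obtain v where "v \<in> weak_ball r" "\<Lambda> = weak_embedding v" by auto
      moreover from this have "v \<in> V" by (simp add: weak_ball_def)
      ultimately show "\<Lambda> ?\<phi> = F (g \<Lambda>)" using dual[OF F] g[of v] by (simp add: weak_embedding_def)
    qed
  qed
  moreover have "compactin (subtopology ?X (weak_embedding ` weak_ball r)) (weak_embedding ` weak_ball r)"
    using compactin_weak_ball[OF refl] by (simp add: compactin_subtopology)
  ultimately have "compactin weak_topology (g ` weak_embedding ` weak_ball r)" by (rule image_compactin[rotated])
  moreover have "g ` weak_embedding ` weak_ball r = T ` weak_ball r"
    using g by (simp add: image_image cong: image_cong)
  ultimately show ?thesis by simp
qed

text \<open>On the compact set \<open>weak_ball r\<close> any separating family of functionals induces the weak topology.\<close>

lemma weakly_continuous_if_separating: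
  assumes refl: "reflexive_on V N" and g: "\<And>s. g s \<in> weak_ball r"
    and \<Psi>: "\<Psi> \<subseteq> D" "\<And>u v. u \<in> V \<Longrightarrow> v \<in> V \<Longrightarrow> (\<And>\<psi>. \<psi> \<in> \<Psi> \<Longrightarrow> \<psi> u = \<psi> v) \<Longrightarrow> u = v"
    and cont: "\<And>\<psi>. \<psi> \<in> \<Psi> \<Longrightarrow> continuous_on UNIV (\<lambda>s. \<psi> (g s))"
    and \<phi>: "\<phi> \<in> D"
  shows "continuous_on UNIV (\<lambda>s :: 's::topological_space. \<phi> (g s))"
proof -
  let ?X = "product_topology (\<lambda>_ :: 'v \<Rightarrow> real. euclideanreal) D"
  let ?Y = "product_topology (\<lambda>_ :: 'v \<Rightarrow> real. euclideanreal) \<Psi>"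
  define \<rho> where "\<rho> \<Lambda> = restrict \<Lambda> \<Psi>" for \<Lambda> :: "('v \<Rightarrow> real) \<Rightarrow> real"
  have proj: "continuous_map ?X euclideanreal (\<lambda>\<Lambda>. \<Lambda> \<psi>)" if "\<psi> \<in> D" for \<psi>
    using continuous_map_product_projection[OF that, of "\<lambda>_. euclideanreal"] by simp
  have \<rho>: "continuous_map ?X ?Y \<rho>"
    unfolding continuous_map_componentwise \<rho>_def
    using \<Psi>(1) proj by (auto simp: subset_iff)
  have \<rho>_emb: "\<rho> (weak_embedding v) = restrict (\<lambda>\<psi>. \<psi> v) \<Psi>" for v
    using \<Psi>(1) by (auto simp: \<rho>_def weak_embedding_def fun_eq_iff restrict_def)
  have g_cont: "continuous_map euclidean ?Y (\<lambda>s. \<rho> (weak_embedding (g s)))"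
    unfolding continuous_map_componentwise \<rho>_emb using cont by auto
  have "closed ((\<lambda>s. \<phi> (g s)) -` Z)" if Z: "closed Z" for Z
  proof -
    \<comment> \<open>The part of the ball on which \<open>\<phi>\<close> takes values in
      \<open>Z\<close> is compact, so its image under the coordinates in \<open>\<Psi>\<close> is
      closed. As \<open>\<Psi>\<close> separates points, \<open>g s\<close> can be tested for
      membership there, and those coordinates are continuous in \<open>s\<close>.\<close>
    let ?C = "weak_embedding ` weak_ball r \<inter> {\<Lambda> \<in> topspace ?X. \<Lambda> \<phi> \<in> Z}"
    have "closedin ?X {\<Lambda> \<in> topspace ?X. \<Lambda> \<phi> \<in> Z}"
      using closedin_continuous_map_preimage[OF proj[OF \<phi>], of Z] Z by simp
    then have "compactin ?X ?C" using compact_Int_closedin[OF compactin_weak_ball[OF refl]] by blast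
    then have "compactin ?Y (\<rho> ` ?C)" using \<rho> by (rule image_compactin)
    then have "closedin ?Y (\<rho> ` ?C)"
      by (rule compactin_imp_closedin[rotated]) (simp add: Hausdorff_space_product_topology)
    then have "closedin euclidean {s \<in> topspace euclidean. \<rho> (weak_embedding (g s)) \<in> \<rho> ` ?C}"
      by (rule closedin_continuous_map_preimage[OF g_cont])
    moreover have "\<rho> (weak_embedding (g s)) \<in> \<rho> ` ?C \<longleftrightarrow> \<phi> (g s) \<in> Z" for s
    proof
      assume "\<rho> (weak_embedding (g s)) \<in> \<rho> ` ?C"
      then obtain v where v: "v \<in> weak_ball r" "weak_embedding v \<phi> \<in> Z"
        and eq: "\<rho> (weak_embedding (g s)) = \<rho> (weak_embedding v)" by auto
      have "g s = v"
      proof (rule \<Psi>(2))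
        fix \<psi> assume "\<psi> \<in> \<Psi>"
        then show "\<psi> (g s) = \<psi> v" using fun_cong[OF eq[unfolded \<rho>_emb], of \<psi>] by simp
      qed (use v g in \<open>auto simp: weak_ball_def\<close>)
      then show "\<phi> (g s) \<in> Z" using v(2) \<phi> by (simp add: weak_embedding_def)
    next
      assume "\<phi> (g s) \<in> Z"
      then show "\<rho> (weak_embedding (g s)) \<in> \<rho> ` ?C"
        using g[of s] \<phi> by (intro imageI IntI) (auto simp: weak_embedding_def)
    qed
    ultimately show ?thesis by (simp add: vimage_def)
  qed
  then show ?thesis by (simp add: continuous_on_closed_vimage)
qed

section \<open>Contractions and the weak operator topology\<close>

lemma contraction_le:
  assumes "T \<in> contractions V N" "x \<in> V"
  shows "N (T x) \<le> N x"
proof -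
  have T: "T \<in> V \<rightarrow>\<^sub>E V" "linear_map_on V T" "operator_norm V N T \<le> 1"
    using assms(1) by (auto simp: contractions_def bounded_operators_def)
  obtain B where B: "\<And>x. x \<in> V \<Longrightarrow> N (T x) \<le> B * N x"
    using assms(1) by (auto simp: contractions_def bounded_operators_def)
  \<comment> \<open>The real supremum defining \<open>operator_norm\<close> is informative only over
    a bounded set; membership in \<open>bounded_operators\<close> supplies the bound.\<close>
  have bdd: "bdd_above ((\<lambda>x. N (T x)) ` {x \<in> V. N x \<le> 1})"
  proof (rule bdd_aboveI2[of _ _ "\<bar>B\<bar>"])
    fix x assume x: "x \<in> {x \<in> V. N x \<le> 1}"
    then have "B * N x \<le> \<bar>B\<bar> * 1" using norm_nonneg by (intro mult_mono) auto
    then show "N (T x) \<le> \<bar>B\<bar>" using B[of x] x by simp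
  qed
  have unit: "N (T y) \<le> 1" if "y \<in> V" "N y \<le> 1" for y
  proof -
    have "N (T y) \<le> operator_norm V N T"
      unfolding operator_norm_def by (rule cSUP_upper[OF _ bdd]) (use that in auto)
    with T(3) show ?thesis by simp
  qed
  show ?thesis
  proof (cases "N x = 0")
    case True
    then show ?thesis using B[OF assms(2)] by simp
  next
    case False
    then have n: "0 < N x" using norm_nonneg[OF assms(2)] by simp
    have "N (T ((1 / N x) *\<^sub>R x)) \<le> 1"
      by (rule unit[OF scale_in[OF assms(2)]]) (use n assms in \<open>simp add: norm_scaleR\<close>)
    moreover have "T ((1 / N x) *\<^sub>R x) = (1 / N x) *\<^sub>R T x" using T(2) assms(2) by (simp add: linear_map_on_def)
    moreover have "T x \<in> V" using T(1) assms(2) by auto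
    ultimately show ?thesis using n by (simp add: norm_scaleR field_simps)
  qed
qed

lemma contractionI:
  assumes "T \<in> V \<rightarrow>\<^sub>E V" "linear_map_on V T" "\<And>x. x \<in> V \<Longrightarrow> N (T x) \<le> N x"
  shows "T \<in> contractions V N"
proof -
  have "operator_norm V N T \<le> 1" unfolding operator_norm_def
  proof (rule cSUP_least)
    show "{x \<in> V. N x \<le> 1} \<noteq> {}" by (auto intro: exI[of _ 0])
  qed (use assms(3) in \<open>auto intro: order_trans\<close>)
  then show ?thesis
    using assms by (auto simp: contractions_def bounded_operators_def intro!: exI[of _ 1])
qed

end

text \<open>With a point of \<open>V\<close> at hand, the zero functional makes the whole function
  space a subbasic set, so the generated topology lives on all functions and the only restriction on
  the range is that to contractions.\<close>

lemma continuous_map_weak_operator_topology: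
  fixes V :: "'a::real_vector set"
  assumes "V \<noteq> {}"
  shows "continuous_map X (weak_operator_topology V N) h \<longleftrightarrow>
    h ` topspace X \<subseteq> contractions V N \<and>
    (\<forall>\<phi>\<in>dual_space V N. \<forall>v\<in>V. continuous_map X euclideanreal (\<lambda>s. \<phi> (h s v)))"
proof -
  let ?B = "{{T :: 'a \<Rightarrow> 'a. \<phi> (T v) \<in> U} |\<phi> v U. \<phi> \<in> dual_space V N \<and> v \<in> V \<and> open (U :: real set)}"
  have "(\<lambda>_. 0) \<in> dual_space V N" by (rule dual_spaceI[where B = 0]) auto
  moreover obtain v where "v \<in> V" using assms by auto
  ultimately have "{T :: 'a \<Rightarrow> 'a. (\<lambda>_. 0 :: real) (T v) \<in> UNIV} \<in> ?B" using open_UNIV by blast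
  then have U: "\<Union> ?B = UNIV" by auto
  have "continuous_map X (topology_generated_by ?B) h \<longleftrightarrow>
      (\<forall>\<phi>\<in>dual_space V N. \<forall>v\<in>V. \<forall>U. open U \<longrightarrow> openin X (h -` {T. \<phi> (T v) \<in> U} \<inter> topspace X))"
    unfolding continuous_on_generated_topo_iff U by blast
  also have "\<dots> \<longleftrightarrow> (\<forall>\<phi>\<in>dual_space V N. \<forall>v\<in>V. continuous_map X euclideanreal (\<lambda>s. \<phi> (h s v)))"
  proof -
    have "h -` {T. \<phi> (T v) \<in> U} \<inter> topspace X = {s \<in> topspace X. \<phi> (h s v) \<in> U}" for \<phi> v and U :: "real set"
      by auto
    then show ?thesis by (simp add: continuous_map_def)
  qed
  finally show ?thesis
    unfolding weak_operator_topology_def continuous_map_in_subtopology by auto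
qed

section \<open>Coefficients of representations, and representations of groups\<close>

lemma representation_coefficient_wap:
  fixes f :: "'s::semitopological_monoid \<Rightarrow>\<^sub>C real" and V :: "'v::real_vector set"
  assumes rep: "reflexive_representation V N h" and coeff: "matrix_coefficient V N h (apply_bcontfun f)"
  shows "weakly_almost_periodic f"
proof -
  interpret banach_space_on V N using rep by (simp add: reflexive_representation_def)
  have refl: "reflexive_on V N" and contr: "\<And>s. h s \<in> contractions V N"
    and hom: "\<And>s t. h (s * t) = compose V (h t) (h s)"
    and hcont: "continuous_map euclidean (weak_operator_topology V N) h"
    using rep by (auto simp: reflexive_representation_def antihomomorphism_on_def)
  obtain v \<psi> where v: "v \<in> V" and \<psi>: "\<psi> \<in> D" and f: "\<And>s. f s = \<psi> (h s v)"
    using coeff by (auto simp: matrix_coefficient_def)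
  have lin: "h s (x + y) = h s x + h s y" "h s (c *\<^sub>R x) = c *\<^sub>R h s x" "h s x \<in> V" if "x \<in> V" "y \<in> V" for s x y c
    using contr[of s] that by (auto simp: contractions_def bounded_operators_def linear_map_on_def)
  have bd: "\<bar>\<psi> (h s u)\<bar> \<le> dual_norm V N \<psi> * N u" if "u \<in> V" for s u
    using dual_norm_bound[OF \<psi> lin(3)[OF that that, of s]]
      mult_left_mono[OF contraction_le[OF contr[of s] that] dual_norm_nonneg[OF \<psi>]] by linarith
  have V: "V \<noteq> {}" using zero_in by blast
  define T where "T u = Bcontfun (\<lambda>t. \<psi> (h t u))" for u
  have T: "apply_bcontfun (T u) = (\<lambda>t. \<psi> (h t u))" if u: "u \<in> V" for u
  proof -
    have "continuous_on UNIV (\<lambda>t. \<psi> (h t u))"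
      using hcont u \<psi> unfolding continuous_map_weak_operator_topology[OF V] by auto
    moreover have "bounded (range (\<lambda>t. \<psi> (h t u)))"
      using bd[OF u] by (auto simp: bounded_iff)
    ultimately show ?thesis unfolding T_def by (intro Bcontfun_inverse) (simp add: bcontfun_def)
  qed
  have compact: "compactin weak_topology (T ` weak_ball (N v))"
  proof (rule compactin_weak_ball_image[OF refl])
    show "T (x + y) = T x + T y" if "x \<in> V" "y \<in> V" for x y
      by (rule bcontfun_eqI) (use that in \<open>simp add: T add_in lin dual_spaceD(1)[OF \<psi>]\<close>)
    show "T (c *\<^sub>R x) = c *\<^sub>R T x" if "x \<in> V" for c x
      by (rule bcontfun_eqI) (use that in \<open>simp add: T scale_in lin dual_spaceD(2)[OF \<psi>]\<close>)
    show "norm (T x) \<le> dual_norm V N \<psi> * N x" if "x \<in> V" for x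
      by (rule norm_bound) (use that bd in \<open>simp add: T\<close>)
  qed
  have "range (translate f) \<subseteq> T ` weak_ball (N v)"
  proof clarify
    fix s
    have hv: "h s v \<in> V" using lin(3)[OF v v] .
    \<comment> \<open>Order reversal is what fits here:
      \<open>f (s * t) = \<psi> (h t (h s v))\<close>, so \<open>s\<close> acts on the vector first
      and \<open>t\<close> remains as the argument.\<close>
    have "translate f s = T (h s v)"
      by (rule bcontfun_eqI) (use hv v in \<open>simp add: T f hom compose_def\<close>)
    moreover have "h s v \<in> weak_ball (N v)"
      by (rule weak_ballI[OF hv contraction_le[OF contr v]])
    ultimately show "translate f s \<in> T ` weak_ball (N v)" by auto
  qed
  then have "weak_topology closure_of range (translate f) \<subseteq> T ` weak_ball (N v)"
    by (rule closure_of_minimal) (rule compactin_imp_closedin[OF Hausdorff_weak_topology compact])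
  then show ?thesis
    unfolding weakly_almost_periodic_def relatively_weakly_compact_def
    by (rule closed_compactin[OF compact]) simp
qed

text \<open>Both \<open>h s\<close> and its inverse are contractions, so neither can strictly shrink
  a norm.\<close>

lemma group_representation_isometric:
  fixes h :: "'s::semitopological_monoid \<Rightarrow> 'v::real_vector \<Rightarrow> 'v"
  assumes group: "\<forall>s::'s. \<exists>t. s * t = 1 \<and> t * s = 1" and rep: "reflexive_representation V N h"
  shows "range h \<subseteq> isometries V N"
proof clarify
  fix s :: 's
  interpret banach_space_on V N using rep by (simp add: reflexive_representation_def)
  have contr: "\<And>s. h s \<in> contractions V N" and one: "h 1 = restrict id V"
    and hom: "\<And>s t. h (s * t) = compose V (h t) (h s)"
    using rep by (auto simp: reflexive_representation_def antihomomorphism_on_def)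
  have hV: "h u \<in> V \<rightarrow>\<^sub>E V" "linear_map_on V (h u)" for u
    using contr[of u] by (auto simp: contractions_def bounded_operators_def)
  obtain t where t: "s * t = 1" "t * s = 1" using group by blast
  have inv: "h t (h s x) = x" "h s (h t x) = x" if "x \<in> V" for x
    using fun_cong[OF hom[of s t], of x] fun_cong[OF hom[of t s], of x] that by (simp_all add: t one compose_def)
  have "N (h s x) = N x" if x: "x \<in> V" for x
  proof (rule antisym)
    show "N (h s x) \<le> N x" by (rule contraction_le[OF contr x])
    have "h s x \<in> V" using hV(1)[of s] x by auto
    then show "N x \<le> N (h s x)" using contraction_le[OF contr, of "h s x" t] inv[OF x] by simp
  qed
  moreover have "h s ` V = V"
  proof
    show "h s ` V \<subseteq> V" using hV(1)[of s] by auto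
    show "V \<subseteq> h s ` V"
    proof
      fix x assume "x \<in> V"
      then show "x \<in> h s ` V" using inv(2)[of x] hV(1)[of t] by (intro image_eqI[of _ _ "h t x"]) auto
    qed
  qed
  ultimately show "h s \<in> isometries V N" using hV[of s] by (simp add: isometries_def)
qed

section \<open>Factorisation through a reflexive space\<close>

text \<open>The interpolation norm of Davis, Figiel, Johnson and Pelczynski for a bounded symmetric convex set \<open>W\<close>, with the
  gauges of \<open>2^n W + 2^-n cball 0 1\<close> replaced by the equivalent K-functionals \<open>kfun W n\<close>.\<close>

definition kfun :: "'a::real_normed_vector set \<Rightarrow> nat \<Rightarrow> 'a \<Rightarrow> real" where
  "kfun W n x = (INF (c, w)\<in>{0..} \<times> W. (1/2)^n * c + 2^n * norm (x - c *\<^sub>R w))"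

text \<open>An l2 norm taken as a supremum of partial sums. Each partial sum is continuous for the
  ambient norm, which is the source of lower semicontinuity.\<close>

definition dfjp_space :: "'a::real_normed_vector set \<Rightarrow> 'a set" where
  "dfjp_space W = {x. bdd_above (range (\<lambda>n. L2_set (\<lambda>i. kfun W i x) {..<n}))}"

definition dfjp_norm :: "'a::real_normed_vector set \<Rightarrow> 'a \<Rightarrow> real" where
  "dfjp_norm W x = (SUP n. L2_set (\<lambda>i. kfun W i x) {..<n})"

locale dfjp =
  fixes W :: "'a::real_normed_vector set" and R :: real
  assumes complete_UNIV: "complete (UNIV :: 'a set)"
    and W_convex: "convex W" and W_0: "0 \<in> W" and W_minus: "w \<in> W \<Longrightarrow> - w \<in> W"
    and W_norm: "w \<in> W \<Longrightarrow> norm w \<le> R" and R_ge: "1 \<le> R"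
begin

abbreviation "q \<equiv> kfun W"
abbreviation "V \<equiv> dfjp_space W"
abbreviation "N \<equiv> dfjp_norm W"
abbreviation "L2 n x \<equiv> L2_set (\<lambda>i. q i x) {..<n}"

section \<open>Estimates for the K-functionals\<close>

lemma q_lower: "0 \<le> c \<Longrightarrow> w \<in> W \<Longrightarrow> q n x \<le> (1/2)^n * c + 2^n * norm (x - c *\<^sub>R w)"
proof -
  assume cw: "0 \<le> c" "w \<in> W"
  have "bdd_below ((\<lambda>(c, w). (1/2)^n * c + 2^n * norm (x - c *\<^sub>R w)) ` ({0..} \<times> W))"
    by (rule bdd_belowI2[of _ 0]) auto
  from cINF_lower[OF this, of "(c, w)"] show ?thesis using cw by (simp add: kfun_def)
qed

lemma q_greatest:
  "(\<And>c w. 0 \<le> c \<Longrightarrow> w \<in> W \<Longrightarrow> z \<le> (1/2)^n * c + 2^n * norm (x - c *\<^sub>R w)) \<Longrightarrow> z \<le> q n x"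
  unfolding kfun_def by (rule cINF_greatest) (use W_0 in auto)

lemma q_approx:
  assumes "q n x < z"
  obtains c w where "0 \<le> c" "w \<in> W" "(1/2)^n * c + 2^n * norm (x - c *\<^sub>R w) < z"
  using assms q_greatest[of z n x] by (meson not_le)

lemma q_nonneg: "0 \<le> q n x"
  by (rule q_greatest) simp

lemma q_le_norm: "q n x \<le> 2^n * norm x"
  using q_lower[of 0 0 n x] W_0 by simp

lemma W_combine:
  assumes "0 \<le> c" "0 \<le> d" "v \<in> W" "w \<in> W"
  obtains u where "u \<in> W" "c *\<^sub>R v + d *\<^sub>R w = (c + d) *\<^sub>R u"
proof (cases "c + d = 0")
  case True
  then have "c = 0" "d = 0" using assms(1,2) by auto
  then show ?thesis by (intro that[of 0]) (auto simp: W_0)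
next
  case False
  then have cd: "0 < c + d" using assms by simp
  have "(c / (c + d)) *\<^sub>R v + (d / (c + d)) *\<^sub>R w \<in> W"
    by (rule convexD[OF W_convex assms(3,4)]) (use cd assms in \<open>auto simp: add_divide_distrib[symmetric]\<close>)
  then show ?thesis using cd by (intro that) (auto simp: scaleR_right_distrib)
qed

lemma q_triangle: "q n (x + y) \<le> q n x + q n y"
proof -
  have "q n (x + y) - ((1/2)^n * c + 2^n * norm (x - c *\<^sub>R v)) \<le> q n y" if c: "0 \<le> c" "v \<in> W" for c v
  proof (rule q_greatest)
    fix d :: real and w assume d: "0 \<le> d" "w \<in> W"
    obtain u where u: "u \<in> W" "c *\<^sub>R v + d *\<^sub>R w = (c + d) *\<^sub>R u" using W_combine[OF c(1) d(1) c(2) d(2)] .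
    have "q n (x + y) \<le> (1/2)^n * (c + d) + 2^n * norm (x + y - (c + d) *\<^sub>R u)"
      using c d u by (intro q_lower) auto
    also have "x + y - (c + d) *\<^sub>R u = (x - c *\<^sub>R v) + (y - d *\<^sub>R w)" by (simp flip: u(2))
    also have "2^n * norm ((x - c *\<^sub>R v) + (y - d *\<^sub>R w)) \<le> 2^n * (norm (x - c *\<^sub>R v) + norm (y - d *\<^sub>R w))"
      by (intro mult_left_mono norm_triangle_ineq) simp
    finally show "q n (x + y) - ((1/2)^n * c + 2^n * norm (x - c *\<^sub>R v)) \<le> (1/2)^n * d + 2^n * norm (y - d *\<^sub>R w)"
      by (simp add: algebra_simps)
  qed
  then have "q n (x + y) - q n y \<le> q n x" by (intro q_greatest) (simp add: algebra_simps)
  then show ?thesis by simp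
qed

lemma q_scale_le: "q n (a *\<^sub>R x) \<le> \<bar>a\<bar> * q n x"
proof (cases "a = 0")
  case True
  then show ?thesis using q_le_norm[of n 0] by simp
next
  case False
  have "q n (a *\<^sub>R x) / \<bar>a\<bar> \<le> q n x"
  proof (rule q_greatest)
    fix c :: real and w assume c: "0 \<le> c" "w \<in> W"
    \<comment> \<open>Symmetry of \<open>W\<close> absorbs the sign of \<open>a\<close>.\<close>
    have "sgn a *\<^sub>R w \<in> W" using c False W_minus by (auto simp: sgn_if)
    then have "q n (a *\<^sub>R x) \<le> (1/2)^n * (\<bar>a\<bar> * c) + 2^n * norm (a *\<^sub>R x - (\<bar>a\<bar> * c) *\<^sub>R (sgn a *\<^sub>R w))"
      using c by (intro q_lower) auto
    also have "a *\<^sub>R x - (\<bar>a\<bar> * c) *\<^sub>R (sgn a *\<^sub>R w) = a *\<^sub>R (x - c *\<^sub>R w)"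
      by (auto simp: sgn_if abs_if algebra_simps)
    also have "norm \<dots> = \<bar>a\<bar> * norm (x - c *\<^sub>R w)" by (rule norm_scaleR)
    finally show "q n (a *\<^sub>R x) / \<bar>a\<bar> \<le> (1/2)^n * c + 2^n * norm (x - c *\<^sub>R w)"
      using False by (simp add: field_simps)
  qed
  then show ?thesis using False by (simp add: field_simps)
qed

lemma q_scale: "q n (a *\<^sub>R x) = \<bar>a\<bar> * q n x"
proof (cases "a = 0")
  case True
  then show ?thesis using q_scale_le[of n 0 x] q_nonneg[of n 0] by simp
next
  case False
  have "q n x \<le> \<bar>inverse a\<bar> * q n (a *\<^sub>R x)" using q_scale_le[of n "inverse a" "a *\<^sub>R x"] False by simp
  then have "\<bar>a\<bar> * q n x \<le> q n (a *\<^sub>R x)" using False by (simp add: field_simps)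
  with q_scale_le[of n a x] show ?thesis by simp
qed

lemma norm_le_q: "norm x \<le> R * q 0 x"
proof -
  have "norm x / R \<le> q 0 x"
  proof (rule q_greatest)
    fix c :: real and w assume c: "0 \<le> c" "w \<in> W"
    have "norm x \<le> norm (c *\<^sub>R w) + norm (x - c *\<^sub>R w)" using norm_triangle_ineq[of "c *\<^sub>R w" "x - c *\<^sub>R w"] by simp
    also have "norm (c *\<^sub>R w) \<le> R * c" using mult_left_mono[OF W_norm[OF c(2)] c(1)] c(1) by (simp add: mult.commute)
    also have "norm (x - c *\<^sub>R w) \<le> R * norm (x - c *\<^sub>R w)" using mult_right_mono[OF R_ge] by fastforce
    finally show "norm x / R \<le> (1/2)^0 * c + 2^0 * norm (x - c *\<^sub>R w)"
      using R_ge by (simp add: field_simps)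
  qed
  then show ?thesis using R_ge by (simp add: field_simps)
qed

lemma q_tendsto:
  assumes "(u \<longlongrightarrow> l) F"
  shows "((\<lambda>n. q i (u n)) \<longlongrightarrow> q i l) F"
proof (rule LIM_zero_cancel, rule Lim_null_comparison)
  have "\<bar>q i x - q i y\<bar> \<le> 2^i * norm (x - y)" for x y
    using q_triangle[of i "x - y" y] q_triangle[of i "y - x" x] q_le_norm[of i "x - y"] q_le_norm[of i "y - x"]
    by (simp add: norm_minus_commute abs_le_iff)
  then show "\<forall>\<^sub>F n in F. norm (q i (u n) - q i l) \<le> 2^i * norm (u n - l)" by simp
  show "((\<lambda>n. 2^i * norm (u n - l)) \<longlongrightarrow> 0) F"
    by (intro tendsto_mult_right_zero tendsto_norm_zero LIM_zero assms)
qed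

section \<open>The interpolation space is a Banach space\<close>

lemma N_leI:
  assumes "\<And>n. L2 n x \<le> c"
  shows "x \<in> V" "N x \<le> c"
  using assms unfolding dfjp_space_def dfjp_norm_def
  by (auto intro!: bdd_aboveI2[of _ _ c] cSUP_least)

lemma L2_le: "x \<in> V \<Longrightarrow> L2 n x \<le> N x"
  unfolding dfjp_space_def dfjp_norm_def by (auto intro: cSUP_upper)

lemma N_nonneg: "x \<in> V \<Longrightarrow> 0 \<le> N x"
  using L2_le[of x 0] by simp

lemma q_le_N: "x \<in> V \<Longrightarrow> q i x \<le> N x"
  using L2_le[of x "Suc i"] member_le_L2_set[of "{..<Suc i}" i "\<lambda>i. q i x"] by simp

lemma norm_le_N: "x \<in> V \<Longrightarrow> norm x \<le> R * N x"
  using order_trans[OF norm_le_q mult_left_mono[OF q_le_N]] R_ge by simp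

lemma V_triangle:
  assumes "x \<in> V" "y \<in> V"
  shows "x + y \<in> V" "N (x + y) \<le> N x + N y"
proof -
  have "L2 n (x + y) \<le> N x + N y" for n
  proof -
    have "L2 n (x + y) \<le> L2_set (\<lambda>i. q i x + q i y) {..<n}"
      by (rule L2_set_mono) (auto simp: q_triangle q_nonneg)
    also have "\<dots> \<le> L2 n x + L2 n y" by (rule L2_set_triangle_ineq)
    finally show ?thesis using L2_le[OF assms(1), of n] L2_le[OF assms(2), of n] by linarith
  qed
  then show "x + y \<in> V" "N (x + y) \<le> N x + N y" by (auto intro: N_leI)
qed

lemma V_scale_le:
  assumes "x \<in> V"
  shows "a *\<^sub>R x \<in> V" "N (a *\<^sub>R x) \<le> \<bar>a\<bar> * N x"
proof -
  have "L2 n (a *\<^sub>R x) \<le> \<bar>a\<bar> * N x" for n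
    using mult_left_mono[OF L2_le[OF assms, of n], of "\<bar>a\<bar>"]
    by (simp add: q_scale L2_set_right_distrib[symmetric])
  then show "a *\<^sub>R x \<in> V" "N (a *\<^sub>R x) \<le> \<bar>a\<bar> * N x" by (auto intro: N_leI)
qed

text \<open>It places ambient limits of \<open>N\<close>-bounded sequences in \<open>V\<close>.
  Completeness uses it, and so does the reflexivity proof, where the representing point is first
  known only in the ambient space.\<close>

lemma N_lower_semicontinuous:
  assumes "u \<longlonglongrightarrow> l" "\<And>n. u n \<in> V" "\<And>n. N (u n) \<le> c"
  shows "l \<in> V" "N l \<le> c"
proof -
  have "L2 k l \<le> c" for k
  proof (rule LIMSEQ_le_const2)
    show "(\<lambda>n. L2 k (u n)) \<longlonglongrightarrow> L2 k l"
      unfolding L2_set_def by (intro tendsto_intros q_tendsto assms(1))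
    show "\<exists>M. \<forall>n\<ge>M. L2 k (u n) \<le> c" using L2_le[OF assms(2)] assms(3) order_trans by blast
  qed
  then show "l \<in> V" "N l \<le> c" by (auto intro: N_leI)
qed

sublocale banach_space_on V N
proof
  have zero: "0 \<in> V" "N 0 \<le> 0"
    by (rule N_leI[where c = 0]; simp add: L2_set_def q_scale[of _ 0 0, simplified])+
  show "subspace V" by (auto simp: subspace_def zero V_triangle V_scale_le)
  show "0 \<le> N x" if "x \<in> V" for x by (rule N_nonneg[OF that])
  show "N x = 0 \<longleftrightarrow> x = 0" if "x \<in> V" for x
    using norm_le_N[OF that] zero N_nonneg[OF zero(1)] by auto
  show "N (x + y) \<le> N x + N y" if "x \<in> V" "y \<in> V" for x y by (rule V_triangle(2)[OF that])
  show "N (c *\<^sub>R x) = \<bar>c\<bar> * N x" if x: "x \<in> V" for x c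
  proof (cases "c = 0")
    case True
    then show ?thesis using zero N_nonneg[OF zero(1)] by simp
  next
    case False
    have "N x \<le> \<bar>inverse c\<bar> * N (c *\<^sub>R x)" using V_scale_le(2)[OF V_scale_le(1)[OF x, of c], of "inverse c"] False by simp
    then have "\<bar>c\<bar> * N x \<le> N (c *\<^sub>R x)" using False by (simp add: field_simps)
    with V_scale_le(2)[OF x, of c] show ?thesis by simp
  qed
  fix u :: "nat \<Rightarrow> 'a"
  assume u: "range u \<subseteq> V" and cauchy: "\<forall>e>0. \<exists>M. \<forall>m\<ge>M. \<forall>n\<ge>M. N (u m - u n) < e"
  have uV: "u n \<in> V" for n using u by auto
  have diffV: "x - y \<in> V" if "x \<in> V" "y \<in> V" for x y
    using V_triangle(1)[OF that(1) V_scale_le(1)[OF that(2), of "-1"]] by simp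
  have "Cauchy u"
  proof (rule CauchyI)
    fix e :: real assume "0 < e"
    then have "0 < e / R" using R_ge by simp
    then obtain M where "\<And>m n. m \<ge> M \<Longrightarrow> n \<ge> M \<Longrightarrow> N (u m - u n) < e / R" using cauchy by blast
    then have "norm (u m - u n) < e" if "m \<ge> M" "n \<ge> M" for m n
      using norm_le_N[OF diffV[OF uV uV], of m n] that R_ge by (fastforce simp: field_simps)
    then show "\<exists>M. \<forall>m\<ge>M. \<forall>n\<ge>M. norm (u m - u n) < e" by blast
  qed
  then obtain l where l: "u \<longlonglongrightarrow> l" using completeE[OF complete_UNIV, of u] by auto
  \<comment> \<open>Lower semicontinuity is applied with \<open>m\<close> fixed and the second index
    tending to infinity.\<close>
  have close: "\<exists>M. \<forall>m\<ge>M. u m - l \<in> V \<and> N (u m - l) \<le> e" if "0 < e" for e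
  proof -
    obtain M where M: "\<And>m n. m \<ge> M \<Longrightarrow> n \<ge> M \<Longrightarrow> N (u m - u n) < e" using cauchy \<open>0 < e\<close> by blast
    have "u m - l \<in> V \<and> N (u m - l) \<le> e" if "m \<ge> M" for m
    proof -
      have "(\<lambda>n. u m - u (n + M)) \<longlonglongrightarrow> u m - l" by (intro tendsto_intros LIMSEQ_ignore_initial_segment l)
      then show ?thesis
        using N_lower_semicontinuous[of "\<lambda>n. u m - u (n + M)" "u m - l" e] diffV[OF uV uV] M[OF that]
        by (simp add: less_imp_le)
    qed
    then show ?thesis by blast
  qed
  obtain m where "u m - l \<in> V" using close[of 1] by auto
  then have "l \<in> V" using diffV[OF uV[of m]] by fastforce
  moreover have "(\<lambda>n. N (u n - l)) \<longlonglongrightarrow> 0"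
  proof (rule LIMSEQ_I)
    fix e :: real assume "0 < e"
    then obtain M where "\<And>m. m \<ge> M \<Longrightarrow> N (u m - l) \<le> e / 2" using close[of "e / 2"] by auto
    then show "\<exists>M. \<forall>n\<ge>M. norm (N (u n - l) - 0) < e"
      using \<open>0 < e\<close> N_nonneg[OF diffV[OF uV \<open>l \<in> V\<close>]] by (intro exI[of _ M]) fastforce
  qed
  ultimately show "\<exists>l\<in>V. (\<lambda>n. N (u n - l)) \<longlonglongrightarrow> 0" by auto
qed

section \<open>Reflexivity of the interpolation space\<close>

text \<open>The first \<open>m\<close> coordinates carry nearly all of \<open>u\<close> and are
  hardly changed by \<open>z k\<close>, which is small in the ambient norm. On the remaining ones
  \<open>u\<close> contributes at most \<open>1\<close> and \<open>z k\<close> at most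
  \<open>c\<close>. So the square of the norm grows by a constant that does not depend on
  \<open>u\<close>.\<close>

lemma N_add_small:
  assumes u: "u \<in> V" and z: "z \<longlonglongrightarrow> 0" "\<And>k. z k \<in> V" "\<And>k. N (z k) \<le> c"
  shows "\<exists>k. (N (u + z k))\<^sup>2 \<le> (N u)\<^sup>2 + (1 + (1 + c)\<^sup>2)"
proof -
  have c: "0 \<le> c" using N_nonneg[OF z(2)] z(3) order_trans by blast
  have sum_sq: "(L2 n x)\<^sup>2 = (\<Sum>i<n. (q i x)\<^sup>2)" for n x by (simp add: L2_set_def sum_nonneg)
  have sum_le: "(\<Sum>i<n. (q i x)\<^sup>2) \<le> (N x)\<^sup>2" if "x \<in> V" for n x
    unfolding sum_sq[symmetric] by (rule power_mono[OF L2_le[OF that]]) simp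
  obtain m where m: "(N u)\<^sup>2 - 1 / 2 \<le> (\<Sum>i<m. (q i u)\<^sup>2)"
  proof -
    have "(\<exists>m. (N u)\<^sup>2 - 1 / 2 \<le> (\<Sum>i<m. (q i u)\<^sup>2))"
    proof (rule ccontr)
      assume "\<not> ?thesis"
      then have "(L2 m u)\<^sup>2 \<le> (N u)\<^sup>2 - 1 / 2" for m by (auto simp: sum_sq not_le less_imp_le)
      then have "L2 m u \<le> sqrt ((N u)\<^sup>2 - 1 / 2)" for m by (simp add: real_le_rsqrt)
      then have "N u \<le> sqrt ((N u)\<^sup>2 - 1 / 2)" by (rule N_leI(2))
      then have "(N u)\<^sup>2 \<le> (N u)\<^sup>2 - 1 / 2"
        using N_nonneg[OF u] by (metis real_sqrt_le_iff real_sqrt_unique)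
      then show False by simp
    qed
    then show ?thesis using that by blast
  qed
  have "(\<lambda>k. \<Sum>i<m. (q i (u + z k))\<^sup>2) \<longlonglongrightarrow> (\<Sum>i<m. (q i (u + 0))\<^sup>2)"
    by (intro tendsto_intros q_tendsto z(1))
  then have "\<forall>\<^sub>F k in sequentially. (\<Sum>i<m. (q i (u + z k))\<^sup>2) < (\<Sum>i<m. (q i u)\<^sup>2) + 1"
    by (intro order_tendstoD(2)) auto
  then obtain k where "(\<Sum>i<m. (q i (u + z k))\<^sup>2) < (\<Sum>i<m. (q i u)\<^sup>2) + 1"
    by (auto simp: eventually_sequentially)
  then have head: "(\<Sum>i<m. (q i (u + z k))\<^sup>2) \<le> (N u)\<^sup>2 + 1" using sum_le[OF u, of m] by linarith
  have split: "(\<Sum>i<n. (q i x)\<^sup>2) = (\<Sum>i<m. (q i x)\<^sup>2) + (\<Sum>i=m..<n. (q i x)\<^sup>2)" if "m \<le> n" for n x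
    using sum.atLeastLessThan_concat[of 0 m n "\<lambda>i. (q i x)\<^sup>2"] that by (simp add: lessThan_atLeast0)
  have tail: "(\<Sum>i=m..<n. (q i (u + z k))\<^sup>2) \<le> (1 + c)\<^sup>2" if "m \<le> n" for n
  proof -
    have "L2_set (\<lambda>i. q i (u + z k)) {m..<n} \<le> L2_set (\<lambda>i. q i u + q i (z k)) {m..<n}"
      by (rule L2_set_mono) (auto simp: q_triangle q_nonneg)
    also have "\<dots> \<le> L2_set (\<lambda>i. q i u) {m..<n} + L2_set (\<lambda>i. q i (z k)) {m..<n}" by (rule L2_set_triangle_ineq)
    also have "L2_set (\<lambda>i. q i u) {m..<n} \<le> 1"
      using m split[OF that, of u] sum_le[OF u, of n] by (simp add: L2_set_def)
    also have "L2_set (\<lambda>i. q i (z k)) {m..<n} \<le> c"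
    proof -
      have "(\<Sum>i=m..<n. (q i (z k))\<^sup>2) \<le> (N (z k))\<^sup>2"
        using split[OF that, of "z k"] sum_le[OF z(2)[of k], of n] sum_nonneg[of "{..<m}" "\<lambda>i. (q i (z k))\<^sup>2"] by simp
      also have "\<dots> \<le> c\<^sup>2" by (rule power_mono[OF z(3) N_nonneg[OF z(2)]])
      finally show ?thesis using c by (simp add: L2_set_def real_le_lsqrt sum_nonneg)
    qed
    finally have "(L2_set (\<lambda>i. q i (u + z k)) {m..<n})\<^sup>2 \<le> (1 + c)\<^sup>2" by (intro power_mono) auto
    then show ?thesis by (simp add: L2_set_def sum_nonneg)
  qed
  have "L2 n (u + z k) \<le> sqrt ((N u)\<^sup>2 + (1 + (1 + c)\<^sup>2))" for n
  proof -
    have "L2 n (u + z k) \<le> L2 (max m n) (u + z k)"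
      unfolding L2_set_def by (intro real_sqrt_le_mono sum_mono2) auto
    also have "(L2 (max m n) (u + z k))\<^sup>2 \<le> (N u)\<^sup>2 + (1 + (1 + c)\<^sup>2)"
      using split[of "max m n" "u + z k"] head tail[of "max m n"] unfolding sum_sq by simp
    then have "L2 (max m n) (u + z k) \<le> sqrt ((N u)\<^sup>2 + (1 + (1 + c)\<^sup>2))" by (simp add: real_le_rsqrt)
    finally show ?thesis .
  qed
  then have "N (u + z k) \<le> sqrt ((N u)\<^sup>2 + (1 + (1 + c)\<^sup>2))" by (rule N_leI(2))
  then have "(N (u + z k))\<^sup>2 \<le> (sqrt ((N u)\<^sup>2 + (1 + (1 + c)\<^sup>2)))\<^sup>2"
    by (rule power_mono) (rule N_nonneg[OF V_triangle(1)[OF u z(2)]])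
  then show ?thesis by (intro exI[of _ k]) (simp add: add_nonneg_nonneg)
qed

text \<open>Gliding hump: sums of \<open>p\<close> suitably chosen members of a bounded sequence converging to \<open>0\<close> in the ambient norm have
  \<open>N\<close>-norm of order \<open>sqrt p\<close>.\<close>

lemma gliding_hump:
  assumes z: "z \<longlonglongrightarrow> 0" "\<And>k. z k \<in> V" "\<And>k. N (z k) \<le> c"
    and \<phi>: "\<phi> \<in> dual_space V N" and d: "0 < d" "\<And>k. d \<le> \<phi> (z k)"
  shows False
proof -
  define A where "A = 1 + (1 + c)\<^sup>2"
  have ex: "\<exists>u\<in>V. (N u)\<^sup>2 \<le> real p * A \<and> real p * d \<le> \<phi> u" for p
  proof (induction p)
    case 0
    show ?case by (rule bexI[of _ 0]) (use \<phi> in \<open>auto simp: dual_0\<close>)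
  next
    case (Suc p)
    then obtain u where u: "u \<in> V" "(N u)\<^sup>2 \<le> real p * A" "real p * d \<le> \<phi> u" by auto
    obtain k where "(N (u + z k))\<^sup>2 \<le> (N u)\<^sup>2 + A" using N_add_small[OF u(1) z] by (auto simp: A_def)
    then show ?case using u d(2)[of k] z(2)[of k]
      by (intro bexI[of _ "u + z k"]) (auto simp: add_in dual_spaceD(1)[OF \<phi>] algebra_simps)
  qed
  define B where "B = dual_norm V N \<phi>"
  \<comment> \<open>The estimate \<open>p * d \<le> B * sqrt (p * A)\<close> fails for such
    \<open>p\<close>.\<close>
  obtain p :: nat where p: "B\<^sup>2 * A < real p * d\<^sup>2"
    using reals_Archimedean3[of "d\<^sup>2"] d(1) by auto
  obtain u where u: "u \<in> V" "(N u)\<^sup>2 \<le> real p * A" "real p * d \<le> \<phi> u" using ex by blast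
  have "real p * d \<le> B * N u" using u(3) dual_norm_bound[OF \<phi> u(1)] by (simp add: B_def)
  then have "(real p * d)\<^sup>2 \<le> (B * N u)\<^sup>2" using d(1) by (intro power_mono) auto
  also have "\<dots> = B\<^sup>2 * (N u)\<^sup>2" by (simp add: power_mult_distrib)
  also have "\<dots> \<le> B\<^sup>2 * (real p * A)" by (intro mult_left_mono u(2)) simp
  finally have "real p * (real p * d\<^sup>2) \<le> real p * (B\<^sup>2 * A)" by (simp add: power2_eq_square algebra_simps)
  moreover have "0 < real p"
  proof (rule ccontr)
    assume "\<not> 0 < real p"
    then have "B\<^sup>2 * A < 0" using p by simp
    moreover have "0 \<le> B\<^sup>2 * A" by (simp add: A_def add_nonneg_nonneg)
    ultimately show False by simp
  qed
  ultimately have "real p * d\<^sup>2 \<le> B\<^sup>2 * A" by (rule mult_left_le_imp_le)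
  with p show False by simp
qed

definition restricted :: "('a \<Rightarrow> real) \<Rightarrow> 'a \<Rightarrow> real" where
  "restricted F x = (if x \<in> V then F x else 0)"

lemma restricted_dual:
  assumes "bounded_linear F"
  shows "restricted F \<in> dual_space V N"
proof -
  interpret F: bounded_linear F by fact
  obtain K where K: "0 \<le> K" "\<And>x. norm (F x) \<le> norm x * K" using F.nonneg_bounded by auto
  have "\<bar>F v\<bar> \<le> (R * K) * N v" if "v \<in> V" for v
    using order_trans[OF K(2)[of v] mult_right_mono[OF norm_le_N[OF that] K(1)]] by (simp add: algebra_simps)
  then show ?thesis
    by (intro dual_spaceI[where B = "R * K"]) (auto simp: restricted_def add_in scale_in F.add F.scaleR)
qed

lemma ball_convex: "convex {y \<in> V. N y \<le> b \<and> r \<le> \<phi> y}" if "\<phi> \<in> dual_space V N"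
proof (rule convexI)
  fix x y s t
  assume x: "x \<in> {y \<in> V. N y \<le> b \<and> r \<le> \<phi> y}" and y: "y \<in> {y \<in> V. N y \<le> b \<and> r \<le> \<phi> y}"
    and st: "0 \<le> s" "0 \<le> t" "s + t = (1::real)"
  have "N (s *\<^sub>R x + t *\<^sub>R y) \<le> s * N x + t * N y"
    using norm_triangle[of "s *\<^sub>R x" "t *\<^sub>R y"] x y st by (simp add: norm_scaleR scale_in)
  also have "\<dots> \<le> s * b + t * b" using x y st by (intro add_mono mult_left_mono) auto
  also have "\<dots> = b" using st by (simp flip: distrib_right)
  finally have "N (s *\<^sub>R x + t *\<^sub>R y) \<le> b" .
  moreover have "s * r + t * r \<le> s * \<phi> x + t * \<phi> y" using x y st by (intro add_mono mult_left_mono) auto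
  then have "r \<le> \<phi> (s *\<^sub>R x + t *\<^sub>R y)"
    using x y st by (simp add: dual_spaceD(1,2)[OF that] scale_in flip: distrib_right)
  ultimately show "s *\<^sub>R x + t *\<^sub>R y \<in> {y \<in> V. N y \<le> b \<and> r \<le> \<phi> y}"
    using x y by (simp add: add_in scale_in)
qed

text \<open>Krein's theorem gives an ambient point \<open>x\<close> representing
  \<open>\<Lambda>\<close> on restrictions of ambient functionals. If
  \<open>\<Lambda> \<phi>\<close> exceeded \<open>\<phi> x\<close> for some other
  \<open>\<phi>\<close>, a bounded sequence in \<open>V\<close> would converge to \<open>x\<close>
  in the ambient norm while \<open>\<phi>\<close> stayed away from \<open>\<phi> x\<close> along it,
  which the gliding hump excludes.\<close>

lemma dfjp_reflexive:
  assumes K: "compactin weak_topology K" "bounded K" "W \<subseteq> convex hull K"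
  shows "reflexive_on V N"
  unfolding reflexive_on_def
proof (intro allI impI)
  fix \<Lambda> :: "('a \<Rightarrow> real) \<Rightarrow> real"
  let ?D = "dual_space V N"
  assume add: "\<forall>\<phi>\<in>?D. \<forall>\<psi>\<in>?D. \<Lambda> (\<lambda>x. \<phi> x + \<psi> x) = \<Lambda> \<phi> + \<Lambda> \<psi>"
    and scale: "\<forall>c. \<forall>\<phi>\<in>?D. \<Lambda> (\<lambda>x. c * \<phi> x) = c * \<Lambda> \<phi>"
    and "\<exists>B. \<forall>\<phi>\<in>?D. \<bar>\<Lambda> \<phi>\<bar> \<le> B * dual_norm V N \<phi>"
  then obtain B0 where B0: "\<forall>\<phi>\<in>?D. \<bar>\<Lambda> \<phi>\<bar> \<le> B0 * dual_norm V N \<phi>" by auto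
  define B where "B = \<bar>B0\<bar> + 1"
  have B: "0 < B" by (simp add: B_def)
  have bound: "\<bar>\<Lambda> \<phi>\<bar> \<le> B * dual_norm V N \<phi>" if "\<phi> \<in> ?D" for \<phi>
    using B0 that mult_right_mono[of B0 B "dual_norm V N \<phi>"] dual_norm_nonneg[OF that]
    by (fastforce simp: B_def)
  have gold: "\<exists>x\<in>V. N x \<le> B \<and> (\<forall>\<phi>\<in>\<Phi>. \<bar>\<phi> x - \<Lambda> \<phi>\<bar> < \<eta>)" if "finite \<Phi>" "\<Phi> \<subseteq> ?D" "0 < \<eta>" for \<Phi> \<eta>
    by (rule goldstine[where \<Lambda> = \<Lambda>, OF _ _ bound B that]) (use add scale in auto)
  have rd: "restricted (blinfun_apply F) \<in> ?D" for F :: "'a \<Rightarrow>\<^sub>L real"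
    by (rule restricted_dual[OF blinfun.bounded_linear_right])
  have "linear (\<lambda>F :: 'a \<Rightarrow>\<^sub>L real. \<Lambda> (restricted (blinfun_apply F)))"
  proof (rule linearI)
    fix F G :: "'a \<Rightarrow>\<^sub>L real" and c :: real
    have "restricted (blinfun_apply (F + G)) = (\<lambda>x. restricted (blinfun_apply F) x + restricted (blinfun_apply G) x)"
      by (auto simp: restricted_def blinfun.add_left)
    then show "\<Lambda> (restricted (blinfun_apply (F + G))) = \<Lambda> (restricted (blinfun_apply F)) + \<Lambda> (restricted (blinfun_apply G))"
      using add rd by simp
    have "restricted (blinfun_apply (c *\<^sub>R F)) = (\<lambda>x. c * restricted (blinfun_apply F) x)"
      by (auto simp: restricted_def blinfun.scaleR_left)
    then show "\<Lambda> (restricted (blinfun_apply (c *\<^sub>R F))) = c *\<^sub>R \<Lambda> (restricted (blinfun_apply F))"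
      using scale rd by simp
  qed
  then obtain x where x: "\<And>F :: 'a \<Rightarrow>\<^sub>L real. \<Lambda> (restricted (blinfun_apply F)) = F x"
  proof (rule krein[OF complete_UNIV _ K(1,2)])
    fix e :: real assume e: "0 < e"
    \<comment> \<open>From \<open>q n y < B + 1\<close> the residue is below
      \<open>(B + 1) / 2^n\<close> and the coefficient below \<open>2^n * (B + 1)\<close>. The
      number \<open>n\<close> brings the residue under \<open>e\<close>; \<open>B + 1\<close> stands
      in for \<open>B\<close> because the infimum defining \<open>q\<close> need not be
      attained.\<close>
    obtain n where n: "(B + 1) / e < 2 ^ n" using real_arch_pow[of 2 "(B + 1) / e"] by auto
    define r where "r = 2 ^ n * (B + 1)"
    have r: "0 < r" using B by (simp add: r_def)
    show "\<exists>r>0. \<forall>\<F> \<eta>. finite \<F> \<longrightarrow> 0 < \<eta> \<longrightarrow> (\<exists>w\<in>convex hull K. \<exists>x. norm (x - r *\<^sub>R w) \<le> e \<and>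
        (\<forall>F\<in>\<F>. \<bar>blinfun_apply F x - \<Lambda> (restricted (blinfun_apply F))\<bar> < \<eta>))"
    proof (rule exI[of _ r], intro conjI allI impI r)
      fix \<F> :: "('a \<Rightarrow>\<^sub>L real) set" and \<eta> :: real
      assume "finite \<F>" "0 < \<eta>"
      then obtain y where y: "y \<in> V" "N y \<le> B"
        "\<And>F. F \<in> \<F> \<Longrightarrow> \<bar>restricted (blinfun_apply F) y - \<Lambda> (restricted (blinfun_apply F))\<bar> < \<eta>"
        using gold[of "(\<lambda>F. restricted (blinfun_apply F)) ` \<F>" \<eta>] rd by auto
      have "q n y < B + 1" using q_le_N[OF y(1), of n] y(2) by simp
      then obtain c w where c: "0 \<le> c" "w \<in> W" and lt: "(1/2)^n * c + 2^n * norm (y - c *\<^sub>R w) < B + 1"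
        by (rule q_approx)
      have "0 \<le> (1/2)^n * c" "0 \<le> 2^n * norm (y - c *\<^sub>R w)" using c by auto
      with lt have "(1/2)^n * c < B + 1" and nb: "2^n * norm (y - c *\<^sub>R w) < B + 1" by linarith+
      then have cr: "c \<le> r" by (simp add: r_def power_one_over field_simps)
      have "2^n * norm (y - c *\<^sub>R w) \<le> 2^n * e"
        using order_trans[OF less_imp_le[OF nb], of "2^n * e"] n e by (simp add: divide_less_eq)
      then have "norm (y - c *\<^sub>R w) \<le> e" by simp
      \<comment> \<open>Shrinking towards \<open>0\<close> stays in \<open>W\<close>, so the same
        radius \<open>r\<close> serves every \<open>y\<close> in the ball.\<close>
      moreover have "(c / r) *\<^sub>R w + (1 - c / r) *\<^sub>R 0 \<in> W"
        by (rule convexD[OF W_convex c(2) W_0]) (use c cr r in auto)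
      then have "(c / r) *\<^sub>R w \<in> convex hull K" using K(3) by auto
      moreover have "r *\<^sub>R ((c / r) *\<^sub>R w) = c *\<^sub>R w" using r by simp
      moreover have "\<forall>F\<in>\<F>. \<bar>blinfun_apply F y - \<Lambda> (restricted (blinfun_apply F))\<bar> < \<eta>"
        using y by (simp add: restricted_def)
      ultimately show "\<exists>w\<in>convex hull K. \<exists>x. norm (x - r *\<^sub>R w) \<le> e \<and>
          (\<forall>F\<in>\<F>. \<bar>blinfun_apply F x - \<Lambda> (restricted (blinfun_apply F))\<bar> < \<eta>)" by metis
    qed
  qed (rule that)
  have approx: "\<exists>y. y \<longlonglongrightarrow> x \<and> (\<forall>k. y k \<in> V \<and> N (y k) \<le> B \<and> r \<le> \<phi> (y k))"
    if \<phi>: "\<phi> \<in> ?D" and r: "r < \<Lambda> \<phi>" for \<phi> r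
  proof -
    \<comment> \<open>Goldstine's theorem, applied to \<open>F\<close> and \<open>\<phi>\<close>
      together, gives a point of the slice near \<open>x\<close> as seen by \<open>F\<close>;
      Mazur's theorem turns this into norm convergence, as the gliding hump requires.\<close>
    have "x \<in> closure {y \<in> V. N y \<le> B \<and> r \<le> \<phi> y}"
    proof (rule mazur[OF ball_convex[OF \<phi>]])
      fix F :: "'a \<Rightarrow>\<^sub>L real" and e :: real assume e: "0 < e"
      obtain y where "y \<in> V" "N y \<le> B" "\<bar>restricted (blinfun_apply F) y - F x\<bar> < min e (\<Lambda> \<phi> - r)"
        "\<bar>\<phi> y - \<Lambda> \<phi>\<bar> < min e (\<Lambda> \<phi> - r)"
        using gold[of "{restricted (blinfun_apply F), \<phi>}" "min e (\<Lambda> \<phi> - r)"] rd \<phi> e r x by auto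
      then show "\<exists>c\<in>{y \<in> V. N y \<le> B \<and> r \<le> \<phi> y}. F c < F x + e"
        by (intro bexI[of _ y]) (auto simp: restricted_def)
    qed
    then show ?thesis unfolding closure_sequential by auto
  qed
  \<comment> \<open>For the zero functional and the level \<open>-1\<close> the slice is the whole
    ball, which suffices to place \<open>x\<close> in \<open>V\<close>.\<close>
  have "\<Lambda> (\<lambda>_. 0) = 0" using scale[rule_format, OF zero_dual, of 0] by simp
  then obtain y where "y \<longlonglongrightarrow> x" "\<And>k. y k \<in> V" "\<And>k. N (y k) \<le> B"
    using approx[OF zero_dual, of "-1"] by auto
  then have xV: "x \<in> V" "N x \<le> B" by (rule N_lower_semicontinuous)+
  have le: "\<Lambda> \<phi> \<le> \<phi> x" if \<phi>: "\<phi> \<in> ?D" for \<phi>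
  proof (rule ccontr)
    assume "\<not> \<Lambda> \<phi> \<le> \<phi> x"
    define d where "d = (\<Lambda> \<phi> - \<phi> x) / 2"
    have d: "0 < d" "\<phi> x + d < \<Lambda> \<phi>" using \<open>\<not> \<Lambda> \<phi> \<le> \<phi> x\<close> by (auto simp: d_def field_simps)
    then obtain y where y: "y \<longlonglongrightarrow> x" "\<And>k. y k \<in> V" "\<And>k. N (y k) \<le> B" "\<And>k. \<phi> x + d \<le> \<phi> (y k)"
      using approx[OF \<phi> d(2)] by auto
    show False
    proof (rule gliding_hump[OF _ _ _ \<phi> d(1)])
      show "(\<lambda>k. y k - x) \<longlonglongrightarrow> 0" by (rule LIM_zero[OF y(1)])
      show "y k - x \<in> V" for k by (rule diff_in[OF y(2) xV(1)])
      show "N (y k - x) \<le> B + B" for k using norm_diff_le[OF y(2) xV(1), of k] y(3)[of k] xV(2) by linarith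
      show "d \<le> \<phi> (y k - x)" for k using y(4)[of k] dual_diff[OF \<phi> y(2) xV(1)] by simp
    qed
  qed
  have "\<Lambda> \<phi> = \<phi> x" if \<phi>: "\<phi> \<in> ?D" for \<phi>
  proof -
    have "\<Lambda> (\<lambda>x. (-1) * \<phi> x) \<le> (-1) * \<phi> x" using le[OF scale_dual[OF \<phi>, of "-1"]] .
    moreover have "\<Lambda> (\<lambda>x. (-1) * \<phi> x) = (-1) * \<Lambda> \<phi>" using scale \<phi> by blast
    ultimately show ?thesis using le[OF \<phi>] by simp
  qed
  with xV(1) show "\<exists>v\<in>V. \<forall>\<phi>\<in>?D. \<Lambda> \<phi> = \<phi> v" by auto
qed

text \<open>With coefficient \<open>c = 1\<close> the residue vanishes, so the K-functionals of
  \<open>w\<close> are dominated by a geometric series.\<close>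

lemma W_subset_V: "W \<subseteq> V"
proof
  fix w assume w: "w \<in> W"
  have "L2 n w \<le> 2" for n
  proof -
    have "L2 n w \<le> (\<Sum>i<n. q i w)" by (rule L2_set_le_sum) (rule q_nonneg)
    also have "\<dots> \<le> (\<Sum>i<n. (1/2)^i)"
      by (rule sum_mono) (use q_lower[of 1 w _ w] w in auto)
    also have "(\<Sum>i<n. (1/2::real)^i) = 2 - 2 * (1/2)^n" by (induction n) auto
    finally show ?thesis by (rule order_trans) simp
  qed
  then show "w \<in> V" by (rule N_leI(1))
qed

text \<open>Interpolation: \<open>T\<close> carries a decomposition of \<open>x\<close> to one of
  \<open>T x\<close> with the same coefficient and no larger residue, so every K-functional
  decreases.\<close>

lemma contraction_on_V:
  assumes T: "\<And>x y. T (x - y) = T x - T y" "\<And>c x. T (c *\<^sub>R x) = c *\<^sub>R T x"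
    and "\<And>x. norm (T x) \<le> norm x" "\<And>w. w \<in> W \<Longrightarrow> T w \<in> W" and x: "x \<in> V"
  shows "T x \<in> V" "N (T x) \<le> N x"
proof -
  have "q n (T x) \<le> q n x" for n
  proof (rule q_greatest)
    fix c :: real and w assume c: "0 \<le> c" "w \<in> W"
    have "q n (T x) \<le> (1/2)^n * c + 2^n * norm (T x - c *\<^sub>R T w)" using assms(4) c by (intro q_lower) auto
    also have "T x - c *\<^sub>R T w = T (x - c *\<^sub>R w)" by (simp add: T)
    also have "2^n * norm (T (x - c *\<^sub>R w)) \<le> 2^n * norm (x - c *\<^sub>R w)" by (intro mult_left_mono assms(3)) simp
    finally show "q n (T x) \<le> (1/2)^n * c + 2^n * norm (x - c *\<^sub>R w)" by simp
  qed
  then have "L2 n (T x) \<le> N x" for n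
    using L2_set_mono[of "{..<n}" "\<lambda>i. q i (T x)" "\<lambda>i. q i x"] L2_le[OF x, of n] q_nonneg by (meson order_trans)
  then show "T x \<in> V" "N (T x) \<le> N x" by (auto intro: N_leI)
qed

end

section \<open>The representation of a weakly almost periodic function\<close>

lemma weak_closure_cball:
  assumes "D \<subseteq> cball (0 :: 'a::real_normed_vector) r"
  shows "weak_topology closure_of D \<subseteq> cball 0 r"
proof
  fix x assume x: "x \<in> weak_topology closure_of D"
  have "x \<in> closure (cball 0 r)"
  proof (rule mazur)
    fix F :: "'a \<Rightarrow>\<^sub>L real" and e :: real assume "0 < e"
    then show "\<exists>c\<in>cball 0 r. F c < F x + e"
      using weak_closure_approx[OF x blinfun.bounded_linear_right, of e F] assms by blast
  qed simp
  then show "x \<in> cball 0 r" by simp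
qed

lemma translate_diff: "translate (f - g) s = translate f s - translate g s"
  and translate_add: "translate (f + g) s = translate f s + translate g s"
  and translate_scaleR: "translate (c *\<^sub>R f) s = c *\<^sub>R translate f s"
  and translate_minus: "translate (- f) s = - translate f s"
  and translate_translate: "translate (translate f s) t = translate f (s * t)"
  and translate_1: "translate f 1 = f"
  by (rule bcontfun_eqI; simp add: mult.assoc)+

lemma norm_translate_le: "norm (translate f s) \<le> norm f"
  by (rule norm_bound) (metis apply_translate norm_bounded)

lemma bounded_linear_evaluation: "bounded_linear (\<lambda>g :: 's::topological_space \<Rightarrow>\<^sub>C real. g t)"
  by (rule bounded_linear_intro[of _ 1]) (simp_all del: real_norm_def add: norm_bounded)

text \<open>The library declares this type to be a complete space over metric domains only.\<close>

lemma complete_bcontfun: "complete (UNIV :: ('s::topological_space \<Rightarrow>\<^sub>C real) set)"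
proof (rule completeI)
  fix u :: "nat \<Rightarrow> 's \<Rightarrow>\<^sub>C real"
  assume "Cauchy u"
  have "uniformly_Cauchy_on UNIV (\<lambda>n. apply_bcontfun (u n))"
  proof (rule uniformly_Cauchy_onI)
    fix e :: real assume "0 < e"
    then obtain M where M: "\<And>m n. m \<ge> M \<Longrightarrow> n \<ge> M \<Longrightarrow> dist (u m) (u n) < e"
      using \<open>Cauchy u\<close> unfolding Cauchy_def by metis
    show "\<exists>M. \<forall>x\<in>UNIV. \<forall>m\<ge>M. \<forall>n\<ge>M. dist (u m x) (u n x) < e"
      using M dist_bounded order_le_less_trans by blast
  qed
  then obtain l where l: "uniform_limit UNIV (\<lambda>n. apply_bcontfun (u n)) l sequentially"
    using Cauchy_uniformly_convergent unfolding uniformly_convergent_on_def by blast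
  obtain l' where "u \<longlonglongrightarrow> l'" by (rule uniform_limit_bcontfunE[OF l sequentially_bot])
  then show "\<exists>l\<in>UNIV. u \<longlonglongrightarrow> l" by auto
qed

lemma wap_representation:
  fixes f :: "'s::semitopological_monoid \<Rightarrow>\<^sub>C real"
  assumes "weakly_almost_periodic f"
  shows "\<exists>(V :: ('s \<Rightarrow>\<^sub>C real) set) N h. reflexive_representation V N h \<and> matrix_coefficient V N h (apply_bcontfun f)"
proof -
  define A where "A = range (translate f) \<union> uminus ` range (translate f)"
  define W where "W = convex hull A"
  define R where "R = max 1 (norm f)"
  have A_norm: "A \<subseteq> cball 0 R" using norm_translate_le[of f] by (auto simp: A_def R_def le_max_iff_disj)
  have A_minus: "uminus ` A = A" by (auto simp: A_def image_Un image_image)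
  have A_translate: "translate a s \<in> A" if "a \<in> A" for a s
    using that by (auto simp: A_def translate_translate translate_minus)
  have W_translate: "translate w s \<in> W" if "w \<in> W" for w s
  proof -
    have "linear (\<lambda>g :: 's \<Rightarrow>\<^sub>C real. translate g s)"
      by (rule linearI) (simp_all add: translate_add translate_scaleR)
    then have "(\<lambda>g. translate g s) ` W = convex hull ((\<lambda>g. translate g s) ` A)"
      unfolding W_def by (rule convex_hull_linear_image)
    also have "\<dots> \<subseteq> W" unfolding W_def by (rule hull_mono) (use A_translate in auto)
    finally show ?thesis using that by auto
  qed
  have fA: "f \<in> A" unfolding A_def using translate_1[of f] by (metis UnI1 rangeI)
  then have fW: "f \<in> W" unfolding W_def by (rule hull_inc)
  interpret dfjp W R
  proof
    show "complete (UNIV :: ('s \<Rightarrow>\<^sub>C real) set)" by (rule complete_bcontfun)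
    show "convex W" by (simp add: W_def)
    show minus: "- w \<in> W" if "w \<in> W" for w
    proof -
      have "uminus ` W = W" unfolding W_def
        using convex_hull_linear_image[of uminus A] A_minus by (simp add: linear_uminus)
      then show ?thesis using that by auto
    qed
    show "0 \<in> W" using convexD_alt[of W f "- f" "1/2"] fW minus[OF fW] by (simp add: W_def)
    show "norm w \<le> R" if "w \<in> W" for w
    proof -
      have "W \<subseteq> cball 0 R" unfolding W_def by (rule hull_minimal[OF A_norm]) simp
      then show ?thesis using that by auto
    qed
    show "1 \<le> R" by (simp add: R_def)
  qed
  have refl: "reflexive_on V N"
  proof (rule dfjp_reflexive)
    let ?C = "weak_topology closure_of range (translate f)"
    have "compactin weak_topology ?C"
      using assms by (simp add: weakly_almost_periodic_def relatively_weakly_compact_def)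
    moreover have "continuous_map weak_topology weak_topology (uminus :: ('s \<Rightarrow>\<^sub>C real) \<Rightarrow> _)"
      by (rule continuous_map_weak_topology)
         (intro continuous_map_bounded_linear_weak bounded_linear_compose[OF _ bounded_linear_minus[OF bounded_linear_ident]])
    ultimately show "compactin weak_topology (?C \<union> uminus ` ?C)"
      by (intro compactin_Un image_compactin)
    \<comment> \<open>Krein's theorem also asks for a norm bound, which the orbit passes on to its
      weak closure.\<close>
    have "?C \<subseteq> cball 0 R" by (rule weak_closure_cball) (use A_norm in \<open>auto simp: A_def\<close>)
    then show "bounded (?C \<union> uminus ` ?C)" by (intro boundedI[of _ R]) auto
    have "range (translate f) \<subseteq> ?C" by (rule closure_of_subset) simp
    then show "W \<subseteq> convex hull (?C \<union> uminus ` ?C)"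
      unfolding W_def A_def by (intro hull_mono) auto
  qed
  define h where "h s = restrict (\<lambda>g. translate g s) V" for s :: 's
  have tV: "translate g s \<in> V" "N (translate g s) \<le> N g" if "g \<in> V" for g s
    using contraction_on_V[of "\<lambda>g. translate g s", OF _ _ norm_translate_le W_translate that]
    by (simp_all add: translate_diff translate_scaleR)
  have h_contr: "h s \<in> contractions V N" for s
    by (rule contractionI)
       (auto simp: h_def tV linear_map_on_def translate_add translate_scaleR add_in scale_in)
  have ev: "restricted (\<lambda>g. apply_bcontfun g t) \<in> dual_space V N" for t
    by (rule restricted_dual[OF bounded_linear_evaluation])
  have cont: "continuous_on UNIV (\<lambda>s. \<phi> (h s v))" if \<phi>: "\<phi> \<in> dual_space V N" and v: "v \<in> V" for \<phi> v
  proof (rule weakly_continuous_if_separating[OF refl _ _ _ _ \<phi>])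
    show "h s v \<in> weak_ball (N v)" for s using tV[OF v] v by (intro weak_ballI) (auto simp: h_def)
    show "range (\<lambda>t. restricted (\<lambda>g. apply_bcontfun g t)) \<subseteq> dual_space V N" using ev by auto
    show "x = y" if "x \<in> V" "y \<in> V"
      "\<And>\<psi>. \<psi> \<in> range (\<lambda>t. restricted (\<lambda>g. apply_bcontfun g t)) \<Longrightarrow> \<psi> x = \<psi> y" for x y
    proof (rule bcontfun_eqI)
      fix t show "x t = y t" using that(3)[OF rangeI, of t] that(1,2) by (simp add: restricted_def)
    qed
    fix \<psi> assume "\<psi> \<in> range (\<lambda>t. restricted (\<lambda>g :: 's \<Rightarrow>\<^sub>C real. apply_bcontfun g t))"
    then obtain t where "\<psi> = restricted (\<lambda>g. apply_bcontfun g t)" by auto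
    \<comment> \<open>The two halves of separate continuity have different tasks: continuity in the
      left factor is used here for the orbit map, and continuity in the right factor makes
      translates continuous functions.\<close>
    then have "\<psi> (h s v) = v (s * t)" for s using tV[OF v] v by (simp add: h_def restricted_def)
    moreover have "continuous_on UNIV (\<lambda>s. v (s * t))"
      by (rule continuous_on_compose2[OF continuous_on_apply_bcontfun continuous_mult_right]) auto
    ultimately show "continuous_on UNIV (\<lambda>s. \<psi> (h s v))" by simp
  qed
  have "V \<noteq> {}" using zero_in by blast
  then have "continuous_map euclidean (weak_operator_topology V N) h"
    using h_contr cont by (auto simp: continuous_map_weak_operator_topology)
  moreover have "antihomomorphism_on V h"
    by (auto simp: antihomomorphism_on_def h_def compose_def fun_eq_iff translate_1 translate_translate tV)
  ultimately have "reflexive_representation V N h"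
    using h_contr refl banach_space_on_axioms by (auto simp: reflexive_representation_def)
  moreover have "matrix_coefficient V N h (apply_bcontfun f)"
    unfolding matrix_coefficient_def
  proof (intro bexI allI)
    show "f \<in> V" using fW W_subset_V by auto
    then show "f s = restricted (\<lambda>g. apply_bcontfun g 1) (h s f)" for s
      by (simp add: h_def restricted_def tV)
  qed (rule ev)
  ultimately show ?thesis by blast
qed

text \<open>The equivalence fixes \<open>C(S)\<close> as ambient type because the constructed space
  is a subspace of it; the second conjunct frees the converse from that choice. The group statement
  concerns every reflexive representation and not just the constructed one.\<close>

theorem theorem5p1:
  fixes f :: "'s::semitopological_monoid \<Rightarrow>\<^sub>C real"
  shows "(weakly_almost_periodic f \<longleftrightarrow>
            (\<exists>(V :: ('s \<Rightarrow>\<^sub>C real) set) N (h :: 's \<Rightarrow> ('s \<Rightarrow>\<^sub>C real) \<Rightarrow> ('s \<Rightarrow>\<^sub>C real)).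
               reflexive_representation V N h \<and> matrix_coefficient V N h (apply_bcontfun f)))
       \<and> (\<forall>(V :: 'v::real_vector set) N (h :: 's \<Rightarrow> 'v \<Rightarrow> 'v).
            reflexive_representation V N h \<and> matrix_coefficient V N h (apply_bcontfun f) \<longrightarrow>
            weakly_almost_periodic f)
       \<and> ((\<forall>s::'s. \<exists>t. s * t = 1 \<and> t * s = 1) \<longrightarrow>
            (\<forall>(V :: 'v set) N (h :: 's \<Rightarrow> 'v \<Rightarrow> 'v).
               reflexive_representation V N h \<longrightarrow> range h \<subseteq> isometries V N))"
proof (intro conjI allI impI iffI)
  assume "weakly_almost_periodic f"
  then show "\<exists>(V :: ('s \<Rightarrow>\<^sub>C real) set) N h.
      reflexive_representation V N h \<and> matrix_coefficient V N h (apply_bcontfun f)"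
    by (rule wap_representation)
qed (auto intro: representation_coefficient_wap group_representation_isometric[THEN subsetD])

end
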